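(* There is a constant $\varepsilon_0>0$ such that for every constant $0<\varepsilon\le\varepsilon_0$, any two-sided, sample-based distribution-free testing algorithm for decision lists over $\{0,1\}^n$ with distance parameter $\varepsilon$ must draw $\tilde{\Omega}(n)$ samples. The same lower bound holds for sample-based distribution-free testing of monotone conjunctions, of conjunctions, and of monotone decision lists.
   Context: A function $f:\{0,1\}^n\to\{0,1\}$ is a decision list if there are a permutation $\pi$ of $[n]$, $\mu\in\{0,1\}^n$, $\nu\in\{0,1\}^{n+1}$ with $f(x)=\nu_j$ for the smallest $j$ with $x_{\pi(j)}=\mu_{\pi(j)}$ and $f(x)=\nu_{n+1}$ if no such $j$ exists; monotone if $\mu=1^n$. A conjunction is an AND of literals; a monotone conjunction is $x\mapsto\bigwedge_{i\in E}x_i$ for some $E\subseteq[n]$. $f$ is $\varepsilon$-far from a class $\mathfrak{C}$ w.r.t. distribution $\mathcal{D}$ if $\Pr_{x\sim\mathcal{D}}[f(x)\ne g(x)]\ge\varepsilon$ for all $g\in\mathfrak{C}$. A sample-based distribution-free tester for $\mathfrak{C}$ receives only independent samples $z_1,\dots,z_q\sim\mathcal{D}$ together with the values $f(z_1),\dots,f(z_q)$ (no other queries), and must accept with probability $\ge2/3$ if $f\in\mathfrak{C}$ and reject with probability $\ge 2/3$ if $f$ is $\varepsilon$-far from $\mathfrak{C}$ w.r.t. $\mathcal{D}$. $\tilde{\Omega}$ hides polylogarithmic factors. *)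

theory Defs
  imports "HOL-Probability.Probability"
begin

definition cube :: "nat \<Rightarrow> (nat \<Rightarrow> bool) set" where
  "cube n = {1..n} \<rightarrow>\<^sub>E UNIV"

text \<open>
  A function \<open>{0,1}\<^sup>n \<Rightarrow> {0,1}\<close> is represented by any \<open>f :: (nat \<Rightarrow> bool) \<Rightarrow> bool\<close>; its values
  outside \<^term>\<open>cube n\<close> are irrelevant to every notion below.
\<close>

definition eval_dl ::
  "nat \<Rightarrow> (nat \<Rightarrow> nat) \<Rightarrow> (nat \<Rightarrow> bool) \<Rightarrow> (nat \<Rightarrow> bool) \<Rightarrow> (nat \<Rightarrow> bool) \<Rightarrow> bool" where
  "eval_dl n \<pi> \<mu> \<nu> x =
     (if \<exists>j\<in>{1..n}. x (\<pi> j) = \<mu> (\<pi> j)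
      then \<nu> (LEAST j. j \<in> {1..n} \<and> x (\<pi> j) = \<mu> (\<pi> j))
      else \<nu> (n + 1))"

definition decision_lists :: "nat \<Rightarrow> ((nat \<Rightarrow> bool) \<Rightarrow> bool) set" where
  "decision_lists n =
     {f. \<exists>\<pi> \<mu> \<nu>. \<pi> permutes {1..n} \<and> \<mu> \<in> cube n \<and> \<nu> \<in> cube (n + 1) \<and>
           (\<forall>x\<in>cube n. f x = eval_dl n \<pi> \<mu> \<nu> x)}"

definition monotone_decision_lists :: "nat \<Rightarrow> ((nat \<Rightarrow> bool) \<Rightarrow> bool) set" where
  "monotone_decision_lists n =
     {f. \<exists>\<pi> \<nu>. \<pi> permutes {1..n} \<and> \<nu> \<in> cube (n + 1) \<and>
           (\<forall>x\<in>cube n. f x = eval_dl n \<pi> (\<lambda>i\<in>{1..n}. True) \<nu> x)}"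

text \<open>
  \<open>P\<close> and \<open>N\<close> are the variables occurring in positive and in negated literals. They may overlap,
  so the constant 0 function is a conjunction (for \<open>n \<ge> 1\<close>); the empty conjunction is constant 1.
\<close>

definition conjunctions :: "nat \<Rightarrow> ((nat \<Rightarrow> bool) \<Rightarrow> bool) set" where
  "conjunctions n =
     {f. \<exists>P N. P \<subseteq> {1..n} \<and> N \<subseteq> {1..n} \<and>
           (\<forall>x\<in>cube n. f x \<longleftrightarrow> (\<forall>i\<in>P. x i) \<and> (\<forall>i\<in>N. \<not> x i))}"

definition monotone_conjunctions :: "nat \<Rightarrow> ((nat \<Rightarrow> bool) \<Rightarrow> bool) set" where
  "monotone_conjunctions n =
     {f. \<exists>E. E \<subseteq> {1..n} \<and> (\<forall>x\<in>cube n. f x \<longleftrightarrow> (\<forall>i\<in>E. x i))}"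

definition far_from ::
  "real \<Rightarrow> (nat \<Rightarrow> bool) pmf \<Rightarrow> ((nat \<Rightarrow> bool) \<Rightarrow> bool) set \<Rightarrow> ((nat \<Rightarrow> bool) \<Rightarrow> bool) \<Rightarrow> bool" where
  "far_from \<epsilon> D C f \<longleftrightarrow> (\<forall>g\<in>C. measure_pmf.prob D {x. f x \<noteq> g x} \<ge> \<epsilon>)"

text \<open>
  A randomized algorithm maps the list of labelled samples to a distribution on
  \<^const>\<open>True\<close> (accept) and \<^const>\<open>False\<close> (reject); it may depend arbitrarily on \<open>n\<close> and \<open>\<epsilon>\<close>.
\<close>

type_synonym sample_algorithm = "((nat \<Rightarrow> bool) \<times> bool) list \<Rightarrow> bool pmf"

definition run_on_samples ::
  "nat \<Rightarrow> sample_algorithm \<Rightarrow> (nat \<Rightarrow> bool) pmf \<Rightarrow> ((nat \<Rightarrow> bool) \<Rightarrow> bool) \<Rightarrow> bool pmf" where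
  "run_on_samples q T D f =
     bind_pmf (replicate_pmf q D) (\<lambda>zs. T (map (\<lambda>z. (z, f z)) zs))"

definition sample_based_df_tester ::
  "nat \<Rightarrow> ((nat \<Rightarrow> bool) \<Rightarrow> bool) set \<Rightarrow> real \<Rightarrow> nat \<Rightarrow> sample_algorithm \<Rightarrow> bool" where
  "sample_based_df_tester n C \<epsilon> q T \<longleftrightarrow>
     (\<forall>D f. set_pmf D \<subseteq> cube n \<longrightarrow>
        (f \<in> C \<longrightarrow> pmf (run_on_samples q T D f) True \<ge> 2 / 3) \<and>
        (far_from \<epsilon> D C f \<longrightarrow> pmf (run_on_samples q T D f) False \<ge> 2 / 3))"

end

theory Submission
  imports Defs "HOL-Computational_Algebra.Polynomial" "HOL-Real_Asymp.Real_Asymp"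
begin

text \<open>
  Take about \<open>n\<close> times a polylogarithmic number of points of the cube, each with logarithmically many
  zeros, any two sharing at most one zero coordinate, and label them by a fixed hard labelling.
  Give the points independent random weights with law \<open>U\<close> or \<open>U'\<close> and sample proportionally to the
  weights. Under \<open>U\<close> few weights are nonzero, so every point in the support has a zero coordinate
  of its own and every labelling is a monotone conjunction. Under \<open>U'\<close> a constant fraction of the
  weights equals 1, and a union bound over the at most \<open>n! 4\<^sup>n 2\<close> decision lists shows that all of
  them err on a constant fraction. The first \<open>O(log n)\<close> moments of \<open>U\<close> and \<open>U'\<close> agree. Simulating the
  samples by rejection from uniform proposals makes the acceptance probability a polynomial in the
  weights, whose degree in each variable is the number of times the point is proposed, which is
  typically \<open>O(log n)\<close>; so the tester cannot distinguish the two cases. Monotone decision lists do not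
  contain the monotone conjunctions, but they do after negating all coordinates.
\<close>

text \<open>The union bound needs well over n log n labelled points of weight 1, so some coordinates
  are zero in several points, up to \<open>r\<close> of them. Private zeros then survive only if all
  but a fraction of about 1/(4r) of the points have weight 0. As both laws have mean 1, this pushes
  \<open>U\<close> onto rare values larger than 4r. Nodes of polynomial growth keep the largest
  value \<open>\<Lambda>\<close> polylogarithmic in n, and the bound on the number of samples is the
  number of points over \<open>\<Lambda>\<close>, up to a constant.

  Both cases use the same labels, so only the weights can reveal the case. Sampling proportionally
  to them divides by their random sum, which makes the acceptance probability a rational function;
  rejection against the constant \<open>\<Lambda>\<close> removes the denominator. Running out of
  proposals counts as acceptance: under \<open>U\<close> this can only help, so the sum needs no
  control there and may be 0, and under \<open>U'\<close> it is rare.\<close>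

section \<open>Moment matching\<close>

text \<open>Lagrange interpolation at m + 1 nodes reproduces x^k. Comparing coefficients of degree m
  > k gives 0 on one side and the divided difference on the other.\<close>

lemma divided_difference_power_zero:
  fixes x :: "nat \<Rightarrow> real"
  assumes inj: "inj_on x {..m}" and k: "k < m"
  shows "(\<Sum>j\<le>m. x j ^ k / (\<Prod>i\<in>{..m}-{j}. x j - x i)) = 0"
proof -
  define w where "w j = 1 / (\<Prod>i\<in>{..m}-{j}. x j - x i)" for j
  define Q where "Q j = (\<Prod>i\<in>{..m}-{j}. [:- x i, 1:])" for j
  define L where "L = (\<Sum>j\<le>m. smult (x j ^ k * w j) (Q j))"
  have deg_Q: "degree (Q j) = m" if "j \<le> m" for j
    unfolding Q_def using that by (subst degree_prod_sum_eq) auto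
  have lc_Q: "coeff (Q j) m = 1" if "j \<le> m" for j
  proof -
    have "lead_coeff (Q j) = 1"
      unfolding Q_def by (simp add: lead_coeff_prod)
    then show ?thesis using deg_Q[OF that] by simp
  qed
  have nz: "(\<Prod>i\<in>{..m}-{j}. x j - x i) \<noteq> 0" if "j \<le> m" for j
    using inj that by (auto simp: inj_on_def)
  have poly_L: "poly L (x t) = x t ^ k" if "t \<le> m" for t
  proof -
    have "poly L (x t) = (\<Sum>j\<le>m. x j ^ k * w j * (\<Prod>i\<in>{..m}-{j}. x t - x i))"
      by (simp add: L_def Q_def poly_sum poly_prod)
    also have "\<dots> = (\<Sum>j\<le>m. if j = t then x t ^ k else 0)"
    proof (intro sum.cong refl)
      fix j assume j: "j \<in> {..m}"
      show "x j ^ k * w j * (\<Prod>i\<in>{..m}-{j}. x t - x i) = (if j = t then x t ^ k else 0)"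
      proof (cases "j = t")
        case True
        then show ?thesis using nz[OF that] by (simp add: w_def)
      next
        case False
        then have "(\<Prod>i\<in>{..m}-{j}. x t - x i) = 0"
          using that by (intro prod_zero) auto
        then show ?thesis using False by simp
      qed
    qed
    also have "\<dots> = x t ^ k" using that by simp
    finally show ?thesis .
  qed
  have "L = monom 1 k"
  proof (rule poly_eqI_degree[where A = "x ` {..m}"])
    show "poly L y = poly (monom 1 k) y" if "y \<in> x ` {..m}" for y
      using that poly_L by (auto simp: poly_monom)
    have "degree L \<le> m"
      unfolding L_def using deg_Q by (intro degree_sum_le) (auto intro: order.trans[OF degree_smult_le])
    moreover have "card (x ` {..m}) = Suc m" using inj by (simp add: card_image)
    ultimately show "degree L < card (x ` {..m})" "degree (monom 1 k :: real poly) < card (x ` {..m})"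
      using k by (auto simp: degree_monom_eq)
  qed
  then have "coeff L m = 0" using k by simp
  moreover have "coeff L m = (\<Sum>j\<le>m. x j ^ k * w j)"
    unfolding L_def by (simp add: coeff_sum lc_Q)
  ultimately show ?thesis by (simp add: w_def)
qed

section \<open>Products over squares and fourth powers\<close>

lemma prod_of_nat_interval: "(\<Prod>i\<in>{1..m}. real i) = fact m"
  by (simp add: fact_prod)

text \<open>The product equals 2 (m!)^2 / ((m - j)! (m + j)!), which is twice the quotient of the
  binomial coefficients (2m choose m + j) and (2m choose m); the central one is the largest.\<close>

lemma prod_square_quotient_le:
  assumes j: "1 \<le> j" "j \<le> m"
  shows "(\<Prod>i\<in>{1..m}-{j}. (real i)^2 / \<bar>(real i)^2 - (real j)^2\<bar>) \<le> 2"
proof -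
  have split: "{1..m}-{j} = {1..<j} \<union> {j<..m}" "{1..<j} \<inter> {j<..m} = {}" using j by auto
  have d1: "(\<Prod>i\<in>{1..<j}. \<bar>real i - real j\<bar>) = fact (j - 1)"
  proof -
    have "(\<Prod>i\<in>{1..<j}. \<bar>real i - real j\<bar>) = (\<Prod>i\<in>{1..j-1}. real i)"
      by (rule prod.reindex_bij_witness[of _ "\<lambda>i. j - i" "\<lambda>i. j - i"]) (use j in auto)
    then show ?thesis using prod_of_nat_interval by simp
  qed
  have d2: "(\<Prod>i\<in>{j<..m}. \<bar>real i - real j\<bar>) = fact (m - j)"
  proof -
    have "(\<Prod>i\<in>{j<..m}. \<bar>real i - real j\<bar>) = (\<Prod>i\<in>{1..m-j}. real i)"
      by (rule prod.reindex_bij_witness[of _ "\<lambda>i. i + j" "\<lambda>i. i - j"]) (use j in auto)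
    then show ?thesis using prod_of_nat_interval by simp
  qed
  have dm: "(\<Prod>i\<in>{1..m}-{j}. \<bar>real i - real j\<bar>) = fact (j - 1) * fact (m - j)"
    unfolding split(1) by (subst prod.union_disjoint) (use split(2) d1 d2 in auto)
  have dp: "(\<Prod>i\<in>{1..m}-{j}. real i + real j) * (2 * real j) * fact j = fact (m + j)"
  proof -
    have "(\<Prod>i\<in>{1..m}-{j}. real i + real j) * (2 * real j) = (\<Prod>i\<in>{1..m}. real i + real j)"
      using j by (subst (2) prod.remove[of _ j]) auto
    also have "\<dots> = (\<Prod>i\<in>{j<..m+j}. real i)"
      by (rule prod.reindex_bij_witness[of _ "\<lambda>i. i - j" "\<lambda>i. i + j"]) auto
    also have "\<dots> * fact j = (\<Prod>i\<in>{1..m+j}. real i)"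
    proof -
      have "{1..m+j} = {1..j} \<union> {j<..m+j}" by auto
      then have "(\<Prod>i\<in>{1..m+j}. real i) = (\<Prod>i\<in>{1..j}. real i) * (\<Prod>i\<in>{j<..m+j}. real i)"
        by (simp only:) (subst prod.union_disjoint, auto)
      then show ?thesis by (simp only: prod_of_nat_interval mult.commute)
    qed
    finally show ?thesis by (simp only: prod_of_nat_interval)
  qed
  have nm: "(\<Prod>i\<in>{1..m}-{j}. real i) * real j = fact m"
    using prod.remove[of "{1..m}" j real] j prod_of_nat_interval[of m] by (simp add: mult.commute)
  have fj: "fact j = real j * fact (j - 1)"
    using j by (cases j) auto
  have "(\<Prod>i\<in>{1..m}-{j}. (real i)^2 / \<bar>(real i)^2 - (real j)^2\<bar>)
      = (\<Prod>i\<in>{1..m}-{j}. real i)^2 /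
        ((\<Prod>i\<in>{1..m}-{j}. \<bar>real i - real j\<bar>) * (\<Prod>i\<in>{1..m}-{j}. real i + real j))"
    by (simp add: prod_dividef prod_power_distrib flip: prod.distrib)
       (intro arg_cong2[where f = "(/)"] refl prod.cong, simp add: power2_eq_square square_diff_square_factored abs_mult)
  also have "\<dots> = 2 * (fact m)^2 / (fact (m - j) * fact (m + j))"
    (is "?a ^ 2 / (_ * ?b) = _")
  proof -
    have b: "?b > 0" using j by (intro prod_pos) auto
    show ?thesis unfolding dm nm[symmetric] dp[symmetric] fj
      using j b by (simp add: field_simps power2_eq_square)
  qed
  also have "\<dots> \<le> 2"
  proof -
    have "(2 * m) choose (m + j) \<le> (2 * m) choose m" by (rule binomial_maximum')
    then have "real ((2 * m) choose (m + j)) \<le> real ((2 * m) choose m)" by simp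
    moreover have "real ((2*m) choose (m + j)) = fact (2*m) / (fact (m + j) * fact (m - j))"
      using j by (subst binomial_fact) (auto simp: mult_2)
    moreover have "real ((2*m) choose m) = fact (2*m) / (fact m * fact m)"
      by (subst binomial_fact) (auto simp: mult_2)
    ultimately have "fact (2*m) / (fact (m + j) * fact (m - j)) \<le> (fact (2*m) / (fact m * fact m) :: real)"
      by simp
    then have "fact m * fact m \<le> (fact (m + j) * fact (m - j) :: real)"
      by (simp add: field_simps)
    then show ?thesis by (simp add: field_simps power2_eq_square)
  qed
  finally show ?thesis .
qed

text \<open>Factor i^4 - j^4 into i^2 - j^2 and i^2 + j^2. The product of squares alone stays near 2
  for j well below the square root of m, so it does not give a bounded sum over j. Each i < j
  contributes a further factor i^2 / (i^2 + j^2), at most 1/2, and this gives geometric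
  decay.\<close>

lemma prod_fourth_power_quotient_le:
  assumes j: "1 \<le> j" "j \<le> m"
  shows "(\<Prod>i\<in>{1..m}-{j}. (real i)^4 / \<bar>(real i)^4 - (real j)^4\<bar>) \<le> 2 * (1/2)^(j - 1)"
proof -
  have "(\<Prod>i\<in>{1..m}-{j}. (real i)^4 / \<bar>(real i)^4 - (real j)^4\<bar>)
      = (\<Prod>i\<in>{1..m}-{j}. (real i)^2 / \<bar>(real i)^2 - (real j)^2\<bar>)
        * (\<Prod>i\<in>{1..m}-{j}. (real i)^2 / ((real i)^2 + (real j)^2))"
  proof (simp only: flip: prod.distrib, intro prod.cong refl)
    fix i assume "i \<in> {1..m}-{j}"
    have "(real i)^4 - (real j)^4 = ((real i)^2 - (real j)^2) * ((real i)^2 + (real j)^2)"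
      by (simp add: algebra_simps flip: power_add)
    then have "\<bar>(real i)^4 - (real j)^4\<bar> = \<bar>(real i)^2 - (real j)^2\<bar> * ((real i)^2 + (real j)^2)"
      by (simp add: abs_mult)
    then show "(real i)^4 / \<bar>(real i)^4 - (real j)^4\<bar> = (real i)^2 / \<bar>(real i)^2 - (real j)^2\<bar>
        * ((real i)^2 / ((real i)^2 + (real j)^2))"
      by (simp flip: power_add)
  qed
  also have "\<dots> \<le> 2 * (1/2)^(j - 1)"
  proof (intro mult_mono prod_square_quotient_le j)
    have "(\<Prod>i\<in>{1..m}-{j}. (real i)^2 / ((real i)^2 + (real j)^2))
        \<le> (\<Prod>i\<in>{1..m}-{j}. if i < j then 1/2 else 1)"
    proof (intro prod_mono conjI)
      fix i assume i: "i \<in> {1..m}-{j}"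
      have "(real i)^2 \<le> (real j)^2" if "i < j" using that by (intro power_mono) auto
      moreover have "(real i)^2 > 0" using i by auto
      moreover have "(real j)^2 \<ge> 0" by simp
      ultimately show "(real i)^2 / ((real i)^2 + (real j)^2) \<le> (if i < j then 1/2 else 1)"
        by (subst pos_divide_le_eq) (auto intro: add_pos_nonneg)
    qed auto
    also have "\<dots> = (1/2)^(j - 1)"
    proof -
      have "({1..m}-{j}) \<inter> {i. i < j} = {1..<j}" using j by auto
      then show ?thesis by (simp add: prod.If_cases)
    qed
    finally show "(\<Prod>i\<in>{1..m}-{j}. (real i)^2 / ((real i)^2 + (real j)^2)) \<le> (1/2)^(j - 1)" .
  qed (auto intro!: prod_nonneg)
  finally show ?thesis .
qed

text \<open>\<open>W\<close> divides each weight by its node and puts the remaining mass at 0. As 0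
  contributes to no positive moment, the moment of order k + 1 of \<open>W\<close> is the moment of
  order k of \<open>v\<close>.\<close>

lemma sum_reweighted:
  fixes val v :: "nat \<Rightarrow> real"
  assumes inj: "inj_on val {..m}" and pos: "\<And>j. j \<le> m \<Longrightarrow> val j > 0"
  defines "W \<equiv> \<lambda>x. if x = 0 then 1 - (\<Sum>j\<le>m. v j / val j) else v (inv_into {..m} val x) / x"
  shows "(\<Sum>x\<in>insert 0 (val ` {..m}). W x * h x)
       = (1 - (\<Sum>j\<le>m. v j / val j)) * h 0 + (\<Sum>j\<le>m. v j / val j * h (val j))"
    and "\<And>j. j \<le> m \<Longrightarrow> W (val j) = v j / val j"
proof -
  have nz: "val j \<noteq> 0" if "j \<le> m" for j using pos[OF that] by simp
  show Wv: "W (val j) = v j / val j" if "j \<le> m" for j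
    using inv_into_f_f[OF inj] nz that by (simp add: W_def)
  have "0 \<notin> val ` {..m}" using nz by force
  then show "(\<Sum>x\<in>insert 0 (val ` {..m}). W x * h x)
       = (1 - (\<Sum>j\<le>m. v j / val j)) * h 0 + (\<Sum>j\<le>m. v j / val j * h (val j))"
    by (simp add: sum.reindex[OF inj] Wv) (simp add: W_def)
qed

text \<open>
  The signed weights are those of the divided difference at the nodes \<open>1 + K j\<^sup>4\<close>, which annihilates
  polynomials of degree below \<open>m\<close>. Nodes growing like \<open>j\<^sup>4\<close> keep a constant fraction of the total
  variation on the node \<open>1\<close>. Dividing the weights by the node values gains one further moment
  and makes all nonzero values but \<open>1\<close> rare.
\<close>

lemma moment_matching_weights:
  fixes K :: real
  assumes m: "m \<ge> 1" and K: "K > 0"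
  obtains J :: "real set" and w w' :: "real \<Rightarrow> real" where
    "finite J" "J \<subseteq> {0..1 + K * real m ^ 4}" "0 \<in> J" "1 \<in> J"
    "\<And>x. x \<in> J \<Longrightarrow> w x \<ge> 0" "\<And>x. x \<in> J \<Longrightarrow> w' x \<ge> 0"
    "(\<Sum>x\<in>J. w x) = 1" "(\<Sum>x\<in>J. w' x) = 1"
    "\<And>k. k \<le> m \<Longrightarrow> (\<Sum>x\<in>J. w x * x ^ k) = (\<Sum>x\<in>J. w' x * x ^ k)"
    "(\<Sum>x\<in>J. w' x * x) = 1" "w' 1 \<ge> 2/5"
    "(\<Sum>x\<in>J. w x * of_bool (x \<noteq> 0)) \<le> 1 / (1 + K)"
proof -
  define val where "val j = 1 + K * real j ^ 4" for j
  have inj: "inj_on val {..m}"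
    using K by (auto simp: inj_on_def val_def power_eq_iff_eq_base)
  have val_ge: "val j \<ge> 1" for j using K by (simp add: val_def)
  have val0: "val 0 = 1" by (simp add: val_def)
  define pr where "pr j = (\<Prod>i\<in>{..m}-{j}. val j - val i)" for j
  have pr_nz: "pr j \<noteq> 0" if "j \<le> m" for j
    using inj that by (auto simp: inj_on_def pr_def)
  \<comment> \<open>Scaled so that the node 1 has signed weight exactly 1. It then lies in the
    positive part, and a bound on the total variation bounds its share.\<close>
  define u where "u j = pr 0 / pr j" for j
  have u0: "u 0 = 1" using pr_nz by (simp add: u_def)
  have u_mom: "(\<Sum>j\<le>m. u j * val j ^ k) = 0" if "k < m" for k
  proof -
    have "(\<Sum>j\<le>m. u j * val j ^ k) = pr 0 * (\<Sum>j\<le>m. val j ^ k / pr j)"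
      by (simp add: u_def sum_distrib_left)
    then show ?thesis using divided_difference_power_zero[OF inj that] by (simp add: pr_def)
  qed
  have abs_u: "\<bar>u j\<bar> \<le> 2 * (1/2)^(j - 1)" if j: "1 \<le> j" "j \<le> m" for j
  proof -
    have d: "val a - val b = K * (real a ^ 4 - real b ^ 4)" for a b
      by (simp add: val_def algebra_simps)
    have s0: "{..m} - {0} = {1..m}" by auto
    have sj: "{..m} - {j} = insert 0 ({1..m} - {j})" using j by auto
    have "\<bar>pr 0\<bar> = (\<Prod>i\<in>{1..m}. K * real i ^ 4)"
      unfolding pr_def d s0 using K by (simp add: abs_prod abs_mult)
    also have "\<dots> = K * real j ^ 4 * (\<Prod>i\<in>{1..m}-{j}. K * real i ^ 4)"
      using j by (subst prod.remove[of _ j]) auto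
    finally have p0: "\<bar>pr 0\<bar> = K * real j ^ 4 * (\<Prod>i\<in>{1..m}-{j}. K * real i ^ 4)" .
    have pj: "\<bar>pr j\<bar> = K * real j ^ 4 * (\<Prod>i\<in>{1..m}-{j}. K * \<bar>real i ^ 4 - real j ^ 4\<bar>)"
      unfolding pr_def d sj using K by (simp add: abs_prod abs_mult abs_minus_commute)
    have "\<bar>u j\<bar> = (\<Prod>i\<in>{1..m}-{j}. K * real i ^ 4) / (\<Prod>i\<in>{1..m}-{j}. K * \<bar>real i ^ 4 - real j ^ 4\<bar>)"
      using K j by (simp add: u_def p0 pj)
    also have "\<dots> = (\<Prod>i\<in>{1..m}-{j}. real i ^ 4 / \<bar>real i ^ 4 - real j ^ 4\<bar>)"
      using K by (simp flip: prod_dividef)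
    also have "\<dots> \<le> 2 * (1/2)^(j - 1)" using prod_fourth_power_quotient_le[OF j] .
    finally show ?thesis .
  qed
  have tv: "(\<Sum>j\<le>m. \<bar>u j\<bar>) \<le> 5"
  proof -
    have "(\<Sum>j\<le>m. \<bar>u j\<bar>) = 1 + (\<Sum>j\<in>{1..m}. \<bar>u j\<bar>)"
    proof -
      have "{..m} = insert 0 {1..m}" by auto
      then show ?thesis using u0 by simp
    qed
    also have "(\<Sum>j\<in>{1..m}. \<bar>u j\<bar>) \<le> (\<Sum>j\<in>{1..m}. 2 * (1/2)^(j - 1))"
      using abs_u by (intro sum_mono) auto
    also have "\<dots> = (\<Sum>j<m. 2 * (1/2)^j)"
      by (rule sum.reindex_bij_witness[of _ Suc "\<lambda>j. j - 1"]) auto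
    also have "\<dots> = 4 * (1 - (1/2)^m)"
      by (simp only: sum_distrib_left[symmetric] geometric_sum) (simp add: field_simps)
    also have "\<dots> \<le> 4" by simp
    finally show ?thesis by simp
  qed
  \<comment> \<open>The moment of order 0 vanishes, so the positive and the negative part have the
    same total \<open>t\<close>. Half of the bound 5 on the total variation is 5/2, whence the share
    2/5 of the node 1.\<close>
  define t where "t = (\<Sum>j\<le>m. max (u j) 0)"
  have t_eq: "t = (\<Sum>j\<le>m. max (- u j) 0)"
  proof -
    have "t - (\<Sum>j\<le>m. max (- u j) 0) = (\<Sum>j\<le>m. u j)"
      unfolding t_def by (simp flip: sum_subtractf) (intro sum.cong, auto)
    also have "\<dots> = 0" using u_mom[of 0] m by simp
    finally show ?thesis by simp
  qed
  have "t + t = (\<Sum>j\<le>m. \<bar>u j\<bar>)"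
    by (subst t_eq, unfold t_def) (simp flip: sum.distrib, intro sum.cong, auto)
  with tv have t_le: "t \<le> 5/2" by simp
  have t_ge: "t \<ge> 1"
    using u0 member_le_sum[of 0 "{..m}" "\<lambda>j. max (u j) 0"] by (simp add: t_def)
  define v where "v j = max (- u j) 0 / t" for j
  define v' where "v' j = max (u j) 0 / t" for j
  have v_nn: "v j \<ge> 0" "v' j \<ge> 0" for j using t_ge by (auto simp: v_def v'_def)
  have v_sum: "(\<Sum>j\<le>m. v j) = 1" using t_ge t_eq by (simp add: v_def flip: sum_divide_distrib)
  have v'_sum: "(\<Sum>j\<le>m. v' j) = 1" using t_ge t_def by (simp add: v'_def flip: sum_divide_distrib)
  have v_mom: "(\<Sum>j\<le>m. v j * val j ^ k) = (\<Sum>j\<le>m. v' j * val j ^ k)" if "k < m" for k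
  proof -
    have "(\<Sum>j\<le>m. v' j * val j ^ k) - (\<Sum>j\<le>m. v j * val j ^ k) = (\<Sum>j\<le>m. u j * val j ^ k) / t"
      unfolding sum_divide_distrib sum_subtractf[symmetric]
      by (intro sum.cong refl) (auto simp: v_def v'_def max_def field_simps)
    then show ?thesis using u_mom[OF that] by simp
  qed
  define W where "W f = (\<lambda>x. if x = 0 then 1 - (\<Sum>j\<le>m. f j / val j) else f (inv_into {..m} val x) / x)" for f
  define J where "J = insert 0 (val ` {..m})"
  have val_pos: "val j > 0" for j using val_ge[of j] by linarith
  have W_sum: "(\<Sum>x\<in>J. W f x * h x)
      = (1 - (\<Sum>j\<le>m. f j / val j)) * h 0 + (\<Sum>j\<le>m. f j / val j * h (val j))" for f h
    unfolding W_def J_def by (rule sum_reweighted(1)[OF inj val_pos])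
  have W_val: "W f (val j) = f j / val j" if "j \<le> m" for f j
    unfolding W_def by (rule sum_reweighted(2)[OF inj val_pos that])
  have W_nn: "W f x \<ge> 0" if "x \<in> J" "\<And>j. f j \<ge> 0" "(\<Sum>j\<le>m. f j) = 1" for f x
  proof -
    have "(\<Sum>j\<le>m. f j / val j) \<le> (\<Sum>j\<le>m. f j)"
      using mult_left_mono[OF val_ge that(2)] by (intro sum_mono) (simp add: divide_le_eq val_pos)
    then have "W f 0 \<ge> 0" using that(3) by (simp add: W_def)
    moreover have "W f (val j) \<ge> 0" if "j \<le> m" for j
      using W_val[OF that] \<open>\<And>j. f j \<ge> 0\<close> val_pos[of j] by simp
    ultimately show ?thesis using that(1) by (auto simp: J_def)
  qed
  have W_one: "(\<Sum>x\<in>J. W f x) = 1" for f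
    using W_sum[of f "\<lambda>_. 1"] by simp
  have W_mom: "(\<Sum>x\<in>J. W f x * x ^ Suc k) = (\<Sum>j\<le>m. f j * val j ^ k)" for f k
    using W_sum[of f "\<lambda>x. x ^ Suc k"] val_pos by (simp add: less_imp_neq[symmetric])
  have val_le: "val j \<le> val m" if "j \<le> m" for j
    using K that by (auto simp: val_def intro!: power_mono)
  show thesis
  proof (rule that[of J "W v" "W v'"])
    show "finite J" "0 \<in> J" by (simp_all add: J_def)
    show "1 \<in> J" using val0 by (force simp: J_def)
    show "J \<subseteq> {0..1 + K * real m ^ 4}"
      using val_le val_pos K by (force simp: J_def val_def less_imp_le)
    show "W v x \<ge> 0" if "x \<in> J" for x using W_nn[OF that v_nn(1) v_sum] .
    show "W v' x \<ge> 0" if "x \<in> J" for x using W_nn[OF that v_nn(2) v'_sum] .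
    show "(\<Sum>x\<in>J. W v x) = 1" "(\<Sum>x\<in>J. W v' x) = 1" by (rule W_one)+
    show "(\<Sum>x\<in>J. W v x * x ^ k) = (\<Sum>x\<in>J. W v' x * x ^ k)" if "k \<le> m" for k
    proof (cases k)
      case 0
      then show ?thesis by (simp add: W_one)
    next
      case (Suc k')
      then show ?thesis using W_mom v_mom[of k'] that by simp
    qed
    show "(\<Sum>x\<in>J. W v' x * x) = 1"
      using W_mom[of v' 0] v'_sum by simp
    have "v' 0 = 1 / t" using u0 by (simp add: v'_def)
    moreover have "1 / t \<ge> 2/5" using t_le t_ge by (simp add: field_simps)
    ultimately show "W v' 1 \<ge> 2/5"
      using W_val[of 0 v'] val0 by simp
    \<comment> \<open>The node 1 is absent from the negative part, so every nonzero value that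
      carries mass under \<open>W v\<close> is at least 1 + K.\<close>
    have v0: "v 0 = 0" using u0 by (simp add: v_def)
    have "(\<Sum>x\<in>J. W v x * of_bool (x \<noteq> 0)) = (\<Sum>j\<le>m. v j / val j)"
      using W_sum[of v "\<lambda>x. of_bool (x \<noteq> 0)"] val_pos by (simp add: less_imp_neq[symmetric])
    also have "\<dots> \<le> (\<Sum>j\<le>m. v j / (1 + K))"
    proof (intro sum_mono)
      fix j
      show "v j / val j \<le> v j / (1 + K)"
      proof (cases "j = 0")
        case False
        then have "1 + K \<le> val j" using K by (simp add: val_def)
        then show ?thesis using v_nn(1) K by (intro divide_left_mono) (auto intro!: mult_pos_pos val_pos)
      qed (simp add: v0)
    qed
    also have "\<dots> = 1 / (1 + K)" by (simp add: v_sum flip: sum_divide_distrib)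
    finally show "(\<Sum>x\<in>J. W v x * of_bool (x \<noteq> 0)) \<le> 1 / (1 + K)" .
  qed
qed

section \<open>Independent weights and rejection sampling\<close>

text \<open>Expectation over independent coordinates with common law \<open>w\<close> on
  \<open>J\<close>, kept as a finite sum so that factoring and exchanging means is plain
  algebra.\<close>

definition iid_mean :: "'i set \<Rightarrow> 'v set \<Rightarrow> ('v \<Rightarrow> real) \<Rightarrow> (('i \<Rightarrow> 'v) \<Rightarrow> real) \<Rightarrow> real" where
  "iid_mean I J w F = (\<Sum>x\<in>I \<rightarrow>\<^sub>E J. (\<Prod>i\<in>I. w (x i)) * F x)"

lemma iid_mean_prod:
  assumes "finite I" "finite J"
  shows "iid_mean I J w (\<lambda>x. \<Prod>i\<in>I. f i (x i)) = (\<Prod>i\<in>I. \<Sum>y\<in>J. w y * f i y)"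
  using assms by (simp add: iid_mean_def prod_sum_PiE flip: prod.distrib)

lemma iid_mean_add: "iid_mean I J w (\<lambda>x. F x + G x) = iid_mean I J w F + iid_mean I J w G"
  by (simp add: iid_mean_def sum.distrib distrib_left)

lemma iid_mean_cmult: "iid_mean I J w (\<lambda>x. c * F x) = c * iid_mean I J w F"
  by (simp add: iid_mean_def sum_distrib_left mult_ac)

lemma iid_mean_sum: "iid_mean I J w (\<lambda>x. \<Sum>a\<in>A. F a x) = (\<Sum>a\<in>A. iid_mean I J w (F a))"
  by (simp add: iid_mean_def sum_distrib_left) (rule sum.swap)

lemma iid_mean_mono:
  assumes "\<And>y. y \<in> J \<Longrightarrow> w y \<ge> 0" and "\<And>x. x \<in> I \<rightarrow>\<^sub>E J \<Longrightarrow> F x \<le> G x"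
  shows "iid_mean I J w F \<le> iid_mean I J w G"
  unfolding iid_mean_def
  using assms by (intro sum_mono mult_left_mono prod_nonneg) (auto simp: PiE_iff)

lemma iid_mean_cong:
  assumes "\<And>x. x \<in> I \<rightarrow>\<^sub>E J \<Longrightarrow> F x = G x"
  shows "iid_mean I J w F = iid_mean I J w G"
  unfolding iid_mean_def using assms by (intro sum.cong) auto

lemma iid_mean_const:
  assumes "finite I" "finite J" "sum w J = 1"
  shows "iid_mean I J w (\<lambda>_. c) = c"
  using iid_mean_prod[OF assms(1,2), of w "\<lambda>_ _. 1"] iid_mean_cmult[of I J w c "\<lambda>_. 1"] assms(3)
  by simp

lemma iid_mean_prod_subset:
  assumes "finite I" "finite J" "sum w J = 1" "A \<subseteq> I"
  shows "iid_mean I J w (\<lambda>x. \<Prod>i\<in>A. f i (x i)) = (\<Prod>i\<in>A. \<Sum>y\<in>J. w y * f i y)"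
proof -
  have A: "(\<Prod>i\<in>I. if i \<in> A then g i else 1) = prod g A" for g :: "'a \<Rightarrow> real"
    using assms(1,4) by (simp add: prod.If_cases Int_absorb1)
  have "iid_mean I J w (\<lambda>x. \<Prod>i\<in>A. f i (x i))
      = iid_mean I J w (\<lambda>x. \<Prod>i\<in>I. if i \<in> A then f i (x i) else 1)"
    by (simp add: A)
  also have "\<dots> = (\<Prod>i\<in>I. \<Sum>y\<in>J. w y * (if i \<in> A then f i y else 1))"
    by (rule iid_mean_prod[OF assms(1,2)])
  also have "\<dots> = (\<Prod>i\<in>I. if i \<in> A then \<Sum>y\<in>J. w y * f i y else 1)"
    using assms(3) by (intro prod.cong) auto
  finally show ?thesis by (simp add: A)
qed

lemma iid_mean_coordinate:
  assumes "finite I" "finite J" "sum w J = 1" "i \<in> I"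
  shows "iid_mean I J w (\<lambda>x. f (x i)) = (\<Sum>y\<in>J. w y * f y)"
  using iid_mean_prod_subset[OF assms(1,2,3), of "{i}" "\<lambda>_. f"] assms(4) by simp

text \<open>
  \<open>accept_mean lam S q h\<close> is the acceptance probability of a tester \<open>\<tau>\<close> that has seen the slots \<open>h\<close>
  and draws \<open>q\<close> further slots from the distribution \<open>lam / S\<close>. In \<open>rejection_mean\<close> these draws come
  from rejection sampling: uniform proposals are kept with probability \<open>lam i / \<Lambda>\<close>, and the run
  accepts if the proposals are used up before \<open>q\<close> of them were kept. \<open>rejection_path\<close> fixes the
  proposals, which makes it a polynomial in \<open>lam\<close>.
\<close>

fun accept_mean :: "'i set \<Rightarrow> ('i list \<Rightarrow> real) \<Rightarrow> ('i \<Rightarrow> real) \<Rightarrow> real \<Rightarrow> nat \<Rightarrow> 'i list \<Rightarrow> real" where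
  "accept_mean I \<tau> lam S 0 h = \<tau> h"
| "accept_mean I \<tau> lam S (Suc q) h = (\<Sum>i\<in>I. lam i / S * accept_mean I \<tau> lam S q (h @ [i]))"

fun rejection_mean ::
  "'i set \<Rightarrow> ('i list \<Rightarrow> real) \<Rightarrow> real \<Rightarrow> ('i \<Rightarrow> real) \<Rightarrow> nat \<Rightarrow> nat \<Rightarrow> 'i list \<Rightarrow> real" where
  "rejection_mean I \<tau> \<Lambda> lam R 0 h = \<tau> h"
| "rejection_mean I \<tau> \<Lambda> lam 0 (Suc q) h = 1"
| "rejection_mean I \<tau> \<Lambda> lam (Suc R) (Suc q) h =
     (\<Sum>i\<in>I. lam i / \<Lambda> * rejection_mean I \<tau> \<Lambda> lam R q (h @ [i])
            + (1 - lam i / \<Lambda>) * rejection_mean I \<tau> \<Lambda> lam R (Suc q) h) / card I"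

fun rejection_path ::
  "('i list \<Rightarrow> real) \<Rightarrow> real \<Rightarrow> ('i \<Rightarrow> real) \<Rightarrow> 'i list \<Rightarrow> nat \<Rightarrow> 'i list \<Rightarrow> real" where
  "rejection_path \<tau> \<Lambda> lam v 0 h = \<tau> h"
| "rejection_path \<tau> \<Lambda> lam [] (Suc q) h = 1"
| "rejection_path \<tau> \<Lambda> lam (i # v) (Suc q) h =
     lam i / \<Lambda> * rejection_path \<tau> \<Lambda> lam v q (h @ [i])
     + (1 - lam i / \<Lambda>) * rejection_path \<tau> \<Lambda> lam v (Suc q) h"

text \<open>A binomial lower tail: the probability that fewer than \<open>q\<close> of
  \<open>R\<close> independent proposals are kept, each with probability \<open>a\<close>.\<close>

fun shortage :: "real \<Rightarrow> nat \<Rightarrow> nat \<Rightarrow> real" where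
  "shortage a R 0 = 0"
| "shortage a 0 (Suc q) = 1"
| "shortage a (Suc R) (Suc q) = a * shortage a R q + (1 - a) * shortage a R (Suc q)"

text \<open>Exponential Markov bound with base 2: the number X of kept proposals has E[2^(-X)] = (1
  - a/2)^R, and a shortage means X < q.\<close>

lemma shortage_bounds:
  assumes "0 \<le> a" "a \<le> 1"
  shows "0 \<le> shortage a R q \<and> shortage a R q \<le> 1 \<and> shortage a R q \<le> 2 ^ q * (1 - a / 2) ^ R"
  using assms
proof (induction a R q rule: shortage.induct)
  case (1 a R)
  then show ?case by simp
next
  case (2 a q)
  then show ?case using one_le_power[of "2::real" "Suc q"] by simp
next
  case (3 a R q)
  then have IH1: "0 \<le> shortage a R q" "shortage a R q \<le> 1" "shortage a R q \<le> 2 ^ q * (1 - a / 2) ^ R"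
    and IH2: "0 \<le> shortage a R (Suc q)" "shortage a R (Suc q) \<le> 1"
      "shortage a R (Suc q) \<le> 2 ^ Suc q * (1 - a / 2) ^ R"
    by auto
  have "shortage a (Suc R) (Suc q) \<le> a * (2 ^ q * (1 - a / 2) ^ R) + (1 - a) * (2 ^ Suc q * (1 - a / 2) ^ R)"
    using IH1 IH2 3(3,4) by (auto intro!: add_mono mult_left_mono)
  also have "\<dots> = 2 ^ Suc q * (1 - a / 2) ^ Suc R" by (simp add: algebra_simps)
  finally have "shortage a (Suc R) (Suc q) \<le> 2 ^ Suc q * (1 - a / 2) ^ Suc R" .
  moreover have "a * shortage a R q + (1 - a) * shortage a R (Suc q) \<le> a * 1 + (1 - a) * 1"
    using IH1 IH2 3(3,4) by (intro add_mono mult_left_mono) auto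
  ultimately show ?case using IH1 IH2 3(3,4) by simp
qed

lemma shortage_zero: "shortage 0 R q = (if q = 0 then 0 else 1)"
  by (induction "0::real" R q rule: shortage.induct) auto

text \<open>A kept proposal has law \<open>lam / S\<close>, however many rejections precede it. So
  the simulation is the true sampler, except that it accepts on a shortage. If \<open>S = 0\<close>,
  all weights vanish, and x / 0 = 0 keeps the recursion valid.\<close>

lemma rejection_mean_eq:
  fixes lam :: "'i \<Rightarrow> real" and \<Lambda> :: real
  assumes I: "finite I" "I \<noteq> {}" and nn: "\<And>i. i \<in> I \<Longrightarrow> lam i \<ge> 0" and \<Lambda>: "\<Lambda> > 0"
  defines "S \<equiv> sum lam I"
  defines "a \<equiv> S / (\<Lambda> * card I)"
  shows "rejection_mean I \<tau> \<Lambda> lam R q h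
       = (1 - shortage a R q) * accept_mean I \<tau> lam S q h + shortage a R q"
proof (induction R arbitrary: q h)
  case 0
  then show ?case by (cases q) auto
next
  case (Suc R)
  show ?case
  proof (cases q)
    case q: (Suc q')
    let ?P = "shortage a R q'" and ?Q = "shortage a R q"
    have S0: "lam i = 0" if "S = 0" "i \<in> I" for i
      using that sum_nonneg_eq_0_iff[OF I(1), of lam] nn by (simp add: S_def)
    have lamS: "lam i / \<Lambda> = \<Lambda> * card I * a / \<Lambda> * (lam i / S)" if "i \<in> I" for i
      using S0[OF _ that] \<Lambda> I by (cases "S = 0") (auto simp: a_def)
    have A: "(\<Sum>i\<in>I. lam i / \<Lambda> * accept_mean I \<tau> lam S q' (h @ [i])) = card I * a * accept_mean I \<tau> lam S q h"
      using \<Lambda> by (simp add: q sum_distrib_left lamS mult.assoc)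
    have lamsum: "(\<Sum>i\<in>I. lam i / \<Lambda>) = card I * a"
      using I \<Lambda> by (simp add: a_def S_def flip: sum_divide_distrib)
    have "rejection_mean I \<tau> \<Lambda> lam (Suc R) q h * card I
        = (\<Sum>i\<in>I. lam i / \<Lambda> * ((1 - ?P) * accept_mean I \<tau> lam S q' (h @ [i]) + ?P)
             + (1 - lam i / \<Lambda>) * ((1 - ?Q) * accept_mean I \<tau> lam S q h + ?Q))"
      using I by (simp only: q rejection_mean.simps Suc.IH) simp
    also have "\<dots> = (1 - ?P) * (\<Sum>i\<in>I. lam i / \<Lambda> * accept_mean I \<tau> lam S q' (h @ [i])) + ?P * (\<Sum>i\<in>I. lam i / \<Lambda>)
             + (card I - (\<Sum>i\<in>I. lam i / \<Lambda>)) * ((1 - ?Q) * accept_mean I \<tau> lam S q h + ?Q)"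
      by (simp only: distrib_left sum.distrib left_diff_distrib sum_subtractf sum_distrib_left sum_distrib_right)
         (simp add: algebra_simps sum.distrib sum_subtractf)
    also have "\<dots> = card I * ((1 - shortage a (Suc R) q) * accept_mean I \<tau> lam S q h + shortage a (Suc R) q)"
      unfolding A lamsum by (simp only: q shortage.simps) (simp only: algebra_simps)
    finally show ?thesis using I by simp
  qed auto
qed

text \<open>The monomial in front is what has been expanded already; it makes the induction go
  through, as each proposal of \<open>i\<close> raises the exponent of \<open>lam i\<close> by at
  most 1. In the end only exponents up to \<open>m\<close> occur, and the means of such monomials
  factor into matched moments.\<close>

lemma rejection_path_mean_eq:
  assumes I: "finite I" and J: "finite J"
    and mom: "\<And>k. k \<le> m \<Longrightarrow> (\<Sum>x\<in>J. w x * x ^ k) = (\<Sum>x\<in>J. w' x * x ^ k)"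
    and v: "set v \<subseteq> I" and deg: "\<And>i. i \<in> I \<Longrightarrow> e i + count_list v i \<le> m"
  shows "iid_mean I J w (\<lambda>lam. (\<Prod>i\<in>I. lam i ^ e i) * rejection_path \<tau> \<Lambda> lam v q h)
       = iid_mean I J w' (\<lambda>lam. (\<Prod>i\<in>I. lam i ^ e i) * rejection_path \<tau> \<Lambda> lam v q h)"
proof -
  have base: "iid_mean I J w (\<lambda>lam. (\<Prod>i\<in>I. lam i ^ e i) * c) = iid_mean I J w' (\<lambda>lam. (\<Prod>i\<in>I. lam i ^ e i) * c)"
    if "\<And>i. i \<in> I \<Longrightarrow> e i \<le> m" for c e
  proof -
    have "iid_mean I J w (\<lambda>lam. \<Prod>i\<in>I. lam i ^ e i) = iid_mean I J w' (\<lambda>lam. \<Prod>i\<in>I. lam i ^ e i)"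
      unfolding iid_mean_prod[OF I J, where f = "\<lambda>i x. x ^ e i"] using mom that by (intro prod.cong) auto
    then show ?thesis by (simp add: iid_mean_cmult mult.commute[of _ c])
  qed
  show ?thesis using v deg
  proof (induction v arbitrary: e q h)
    case Nil
    then show ?case by (cases q) (use base[of e 1] base[of e "\<tau> h"] in auto)
  next
    case (Cons j v)
    show ?case
    proof (cases q)
      case 0
      then show ?thesis using base[of e] Cons.prems(2) by (auto dest: add_leD1)
    next
      case (Suc q')
      let ?e = "e(j := Suc (e j))"
      have pe: "(\<Prod>i\<in>I. lam i ^ ?e i) = (\<Prod>i\<in>I. lam i ^ e i) * lam j" for lam :: "'a \<Rightarrow> real"
      proof -
        have "(\<Prod>i\<in>I. lam i ^ ?e i) = (\<Prod>i\<in>I. lam i ^ e i * (if i = j then lam j else 1))"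
          by (intro prod.cong) auto
        then show ?thesis using I Cons.prems(1) by (simp add: prod.distrib)
      qed
      have split: "iid_mean I J u (\<lambda>lam. (\<Prod>i\<in>I. lam i ^ e i) * rejection_path \<tau> \<Lambda> lam (j # v) q h)
          = 1 / \<Lambda> * iid_mean I J u (\<lambda>lam. (\<Prod>i\<in>I. lam i ^ ?e i) * rejection_path \<tau> \<Lambda> lam v q' (h @ [j]))
          + (iid_mean I J u (\<lambda>lam. (\<Prod>i\<in>I. lam i ^ e i) * rejection_path \<tau> \<Lambda> lam v q h)
             + (- 1 / \<Lambda>) * iid_mean I J u (\<lambda>lam. (\<Prod>i\<in>I. lam i ^ ?e i) * rejection_path \<tau> \<Lambda> lam v q h))" for u
        unfolding iid_mean_cmult[symmetric] iid_mean_add[symmetric] pe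
        by (rule iid_mean_cong) (simp add: Suc algebra_simps)
      have "?e i + count_list v i \<le> m" "e i + count_list v i \<le> m" if "i \<in> I" for i
        using Cons.prems(2)[OF that] by (auto split: if_splits)
      then have IH: "iid_mean I J w (\<lambda>lam. (\<Prod>i\<in>I. lam i ^ e' i) * rejection_path \<tau> \<Lambda> lam v q h)
         = iid_mean I J w' (\<lambda>lam. (\<Prod>i\<in>I. lam i ^ e' i) * rejection_path \<tau> \<Lambda> lam v q h)"
        if "e' \<in> {e, ?e}" for e' q h
        using that Cons.prems(1) by (intro Cons.IH) auto
      show ?thesis unfolding split by (simp only: IH insertI1 insertI2)
    qed
  qed
qed

section \<open>Averages over proposal lists\<close>

lemma sum_lists_length_Suc:
  assumes "finite I"
  shows "(\<Sum>v | set v \<subseteq> I \<and> length v = Suc R. f v)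
       = (\<Sum>i\<in>I. \<Sum>v | set v \<subseteq> I \<and> length v = R. f (i # v))"
proof -
  have "{v. set v \<subseteq> I \<and> length v = Suc R} = (\<lambda>(i, v). i # v) ` (I \<times> {v. set v \<subseteq> I \<and> length v = R})"
    by (auto simp: length_Suc_conv image_iff)
  moreover have "inj_on (\<lambda>(i, v). i # v) (I \<times> {v. set v \<subseteq> I \<and> length v = R})"
    by (auto simp: inj_on_def)
  ultimately show ?thesis
    by (simp add: sum.reindex sum.cartesian_product case_prod_unfold)
qed

lemma rejection_mean_eq_path_average:
  assumes I: "finite I" "I \<noteq> {}"
  shows "rejection_mean I \<tau> \<Lambda> lam R q h
       = (\<Sum>v | set v \<subseteq> I \<and> length v = R. rejection_path \<tau> \<Lambda> lam v q h) / card I ^ R"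
proof (induction R arbitrary: q h)
  case 0
  have "{v. set v \<subseteq> I \<and> length v = 0} = {[]}" by auto
  then show ?case by (cases q) auto
next
  case (Suc R)
  show ?case
  proof (cases q)
    case 0
    then show ?thesis using I by (simp add: card_lists_length_eq)
  next
    case q: (Suc q')
    have "(\<Sum>v | set v \<subseteq> I \<and> length v = R. rejection_path \<tau> \<Lambda> lam (i # v) q h)
        = (lam i / \<Lambda> * rejection_mean I \<tau> \<Lambda> lam R q' (h @ [i])
           + (1 - lam i / \<Lambda>) * rejection_mean I \<tau> \<Lambda> lam R q h) * card I ^ R" for i
      using I by (simp only: q rejection_path.simps sum.distrib Suc.IH flip: sum_distrib_left)
        (simp add: distrib_right)
    then show ?thesis
      using I by (simp add: q sum_lists_length_Suc[OF I(1)] flip: sum_distrib_right)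
  qed
qed

lemma rejection_path_bounds:
  assumes "\<And>h. 0 \<le> \<tau> h \<and> \<tau> h \<le> 1" and "\<And>i. i \<in> set v \<Longrightarrow> 0 \<le> lam i \<and> lam i \<le> \<Lambda>" and "\<Lambda> > 0"
  shows "0 \<le> rejection_path \<tau> \<Lambda> lam v q h \<and> rejection_path \<tau> \<Lambda> lam v q h \<le> 1"
  using assms(2)
proof (induction v arbitrary: q h)
  case Nil
  then show ?case using assms(1) by (cases q) auto
next
  case (Cons i v)
  have IH: "0 \<le> rejection_path \<tau> \<Lambda> lam v q h \<and> rejection_path \<tau> \<Lambda> lam v q h \<le> 1" for q h
    using Cons by auto
  show ?case
  proof (cases q)
    case (Suc q')
    have f: "0 \<le> lam i / \<Lambda>" "lam i / \<Lambda> \<le> 1" using Cons.prems[of i] assms(3) by auto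
    have "rejection_path \<tau> \<Lambda> lam (i # v) q h \<le> lam i / \<Lambda> * 1 + (1 - lam i / \<Lambda>) * 1"
      unfolding Suc rejection_path.simps using IH f by (intro add_mono mult_left_mono) auto
    moreover have "0 \<le> rejection_path \<tau> \<Lambda> lam (i # v) q h"
      unfolding Suc rejection_path.simps using IH f by (intro add_nonneg_nonneg mult_nonneg_nonneg) auto
    ultimately show ?thesis by simp
  qed (use assms(1) in auto)
qed

lemma sum_two_power_count_list:
  assumes "finite I" "i \<in> I"
  shows "(\<Sum>v | set v \<subseteq> I \<and> length v = R. 2 ^ count_list v i) = (real (card I) + 1) ^ R"
proof (induction R)
  case 0
  have "{v. set v \<subseteq> I \<and> length v = 0} = {[]}" by auto
  then show ?case by simp
next
  case (Suc R)
  have "(\<Sum>v | set v \<subseteq> I \<and> length v = Suc R. 2 ^ count_list v i)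
      = (\<Sum>j\<in>I. (if j = i then 2 else 1) * (real (card I) + 1) ^ R)"
    unfolding sum_lists_length_Suc[OF assms(1)] Suc[symmetric]
    by (intro sum.cong refl) (auto simp: sum_distrib_left)
  also have "\<dots> = (real (card I) + 1) ^ Suc R"
  proof -
    have "(\<Sum>j\<in>I. (if j = i then 2 else 1)) = (\<Sum>j\<in>I. 1 + (if j = i then 1 else 0 :: real))"
      by (intro sum.cong) auto
    also have "\<dots> = real (card I) + 1" using assms by (simp add: sum.distrib)
    finally show ?thesis by (simp flip: sum_distrib_right)
  qed
  finally show ?case .
qed

text \<open>For a uniform list of length N over N slots, 2 to the number of occurrences of a fixed
  slot has mean (1 + 1/N)^N, at most 3. Markov's inequality and a union bound over the slots
  finish.\<close>

lemma card_overloaded_lists: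
  assumes "finite I" "I \<noteq> {}"
  shows "card {v. set v \<subseteq> I \<and> length v = card I \<and> (\<exists>i\<in>I. count_list v i > m)}
       \<le> 3 * real (card I) / 2 ^ Suc m * real (card I) ^ card I"
proof -
  define N where "N = card I"
  have N: "N > 0" using assms by (simp add: N_def card_gt_0_iff)
  let ?L = "{v. set v \<subseteq> I \<and> length v = N}"
  have fin: "finite ?L" using assms(1) by (rule finite_lists_length_eq)
  have one: "real (card {v \<in> ?L. count_list v i > m}) \<le> 3 / 2 ^ Suc m * real N ^ N" if "i \<in> I" for i
  proof -
    have "2 ^ Suc m * real (card {v \<in> ?L. count_list v i > m}) = (\<Sum>v\<in>{v \<in> ?L. count_list v i > m}. 2 ^ Suc m)"
      by simp
    also have "\<dots> \<le> (\<Sum>v\<in>{v \<in> ?L. count_list v i > m}. 2 ^ count_list v i)"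
      by (intro sum_mono power_increasing) auto
    also have "\<dots> \<le> (\<Sum>v\<in>?L. 2 ^ count_list v i)"
      using fin by (intro sum_mono2) auto
    also have "\<dots> = (real N + 1) ^ N" using sum_two_power_count_list[OF assms(1) that, of N] by (simp add: N_def)
    also have "\<dots> = (1 + 1 / real N) ^ N * real N ^ N"
      using N by (simp add: field_simps flip: power_mult_distrib)
    also have "\<dots> \<le> 3 * real N ^ N"
    proof (rule mult_right_mono)
      have "(1 + 1 / real N) ^ N \<le> exp (1 / real N) ^ N"
        by (intro power_mono exp_ge_add_one_self) auto
      also have "\<dots> = exp 1" using N by (simp flip: exp_of_nat_mult)
      also have "\<dots> \<le> 3" by (rule exp_le)
      finally show "(1 + 1 / real N) ^ N \<le> 3" .
    qed simp
    finally show ?thesis by (simp add: field_simps)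
  qed
  have "{v. set v \<subseteq> I \<and> length v = N \<and> (\<exists>i\<in>I. count_list v i > m)} = (\<Union>i\<in>I. {v \<in> ?L. count_list v i > m})"
    by auto
  then have "real (card {v. set v \<subseteq> I \<and> length v = N \<and> (\<exists>i\<in>I. count_list v i > m)})
      \<le> (\<Sum>i\<in>I. real (card {v \<in> ?L. count_list v i > m}))"
    using card_UN_le[OF assms(1), of "\<lambda>i. {v \<in> ?L. count_list v i > m}"] by (simp flip: of_nat_sum)
  also have "\<dots> \<le> (\<Sum>i\<in>I. 3 / 2 ^ Suc m * real N ^ N)" by (intro sum_mono one)
  finally show ?thesis by (simp add: N_def mult_ac)
qed

text \<open>Lists in which no slot occurs more than \<open>m\<close> times have the same mean under
  \<open>w\<close> and \<open>w'\<close>. The others change the sum by at most 1 each, and they are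
  few.\<close>

lemma iid_mean_rejection_mean_close:
  assumes I: "finite I" "I \<noteq> {}" and J: "finite J" "J \<subseteq> {0..\<Lambda>}" and \<Lambda>: "\<Lambda> > 0"
    and w: "\<And>x. x \<in> J \<Longrightarrow> w x \<ge> 0" "sum w J = 1"
    and w': "\<And>x. x \<in> J \<Longrightarrow> w' x \<ge> 0" "sum w' J = 1"
    and mom: "\<And>k. k \<le> m \<Longrightarrow> (\<Sum>x\<in>J. w x * x ^ k) = (\<Sum>x\<in>J. w' x * x ^ k)"
    and \<tau>: "\<And>h. 0 \<le> \<tau> h \<and> \<tau> h \<le> 1"
  shows "iid_mean I J w (\<lambda>lam. rejection_mean I \<tau> \<Lambda> lam (card I) q [])
       \<le> iid_mean I J w' (\<lambda>lam. rejection_mean I \<tau> \<Lambda> lam (card I) q []) + 3 * real (card I) / 2 ^ Suc m"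
proof -
  let ?L = "{v. set v \<subseteq> I \<and> length v = card I}"
  let ?bad = "\<lambda>v. \<exists>i\<in>I. count_list v i > m"
  let ?E = "\<lambda>u v. iid_mean I J u (\<lambda>lam. rejection_path \<tau> \<Lambda> lam v q [])"
  have fin: "finite ?L" using I(1) by (rule finite_lists_length_eq)
  have E: "iid_mean I J u (\<lambda>lam. rejection_mean I \<tau> \<Lambda> lam (card I) q []) = (\<Sum>v\<in>?L. ?E u v) / card I ^ card I" for u
    unfolding rejection_mean_eq_path_average[OF I] divide_inverse
    by (simp only: mult.commute[of _ "inverse _"] iid_mean_cmult iid_mean_sum)
  have path: "0 \<le> rejection_path \<tau> \<Lambda> lam v q [] \<and> rejection_path \<tau> \<Lambda> lam v q [] \<le> 1"
    if "lam \<in> I \<rightarrow>\<^sub>E J" "v \<in> ?L" for lam v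
  proof (rule rejection_path_bounds[OF \<tau> _ \<Lambda>])
    fix i assume "i \<in> set v"
    then have "lam i \<in> J" using that by (auto intro: PiE_mem)
    then show "0 \<le> lam i \<and> lam i \<le> \<Lambda>" using J(2) by auto
  qed
  have step: "?E w v \<le> ?E w' v + of_bool (?bad v)" if v: "v \<in> ?L" for v
  proof (cases "?bad v")
    case True
    have "?E w v \<le> iid_mean I J w (\<lambda>_. 1)" using path v by (intro iid_mean_mono w) auto
    moreover have "iid_mean I J w' (\<lambda>_. 0) \<le> ?E w' v" using path v by (intro iid_mean_mono w') auto
    ultimately show ?thesis using True iid_mean_const[OF I(1) J(1)] w w' by simp
  next
    case False
    then show ?thesis
      using rejection_path_mean_eq[OF I(1) J(1) mom, where e = "\<lambda>_. 0" and v = v and \<tau> = \<tau> and \<Lambda> = \<Lambda> and q = q and h = "[]"] v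
      by (auto simp: not_less)
  qed
  have "(\<Sum>v\<in>?L. ?E w v) \<le> (\<Sum>v\<in>?L. ?E w' v) + (\<Sum>v\<in>?L. of_bool (?bad v))"
    unfolding sum.distrib[symmetric] by (intro sum_mono step)
  also have "(\<Sum>v\<in>?L. of_bool (?bad v)) = real (card {v. set v \<subseteq> I \<and> length v = card I \<and> ?bad v})"
    using fin by (simp add: Int_def conj_assoc)
  also note card_overloaded_lists[OF I, of m]
  finally have "(\<Sum>v\<in>?L. ?E w v) \<le> (\<Sum>v\<in>?L. ?E w' v) + 3 * real (card I) / 2 ^ Suc m * real (card I) ^ card I"
    by simp
  moreover have pos: "real (card I) ^ card I > 0" using I by (simp add: card_gt_0_iff)
  ultimately have "(\<Sum>v\<in>?L. ?E w v) / real (card I) ^ card I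
      \<le> ((\<Sum>v\<in>?L. ?E w' v) + 3 * real (card I) / 2 ^ Suc m * real (card I) ^ card I) / real (card I) ^ card I"
    by (intro divide_right_mono) auto
  also have "\<dots> = (\<Sum>v\<in>?L. ?E w' v) / real (card I) ^ card I + 3 * real (card I) / 2 ^ Suc m"
    using pos by (subst add_divide_distrib) simp
  finally show ?thesis unfolding E by simp
qed

section \<open>Points with nearly disjoint zero sets\<close>

text \<open>Slot (a, b) is the integer line t -> a t + b. The coordinates are cut into blocks of
  length 2p, and the line places one zero in each of \<open>s\<close> blocks. The leading 1 is there
  because coordinates start at 1.\<close>

definition slot_coord :: "nat \<Rightarrow> nat \<times> nat \<Rightarrow> nat \<Rightarrow> nat" where
  "slot_coord p i t = 1 + (t * (2 * p) + (fst i * t + snd i))"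

definition slot_zeros :: "nat \<Rightarrow> nat \<Rightarrow> nat \<times> nat \<Rightarrow> nat set" where
  "slot_zeros p s i = slot_coord p i ` {..<s}"

definition slot_point :: "nat \<Rightarrow> nat \<Rightarrow> nat \<Rightarrow> nat \<times> nat \<Rightarrow> nat \<Rightarrow> bool" where
  "slot_point n p s i = (\<lambda>c\<in>{1..n}. c \<notin> slot_zeros p s i)"

lemma slot_point_in_cube: "slot_point n p s i \<in> cube n"
  by (simp add: slot_point_def cube_def)

text \<open>With slopes below \<open>r\<close> and intercepts below \<open>p\<close>, the first
  assumption keeps a t + b below the block length 2p, and the second fits \<open>s\<close> blocks
  into n coordinates.\<close>

locale slots =
  fixes n p r s :: nat
  assumes rs: "r * s \<le> p" and ps: "2 * p * s \<le> n"
begin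

definition I :: "(nat \<times> nat) set" where "I = {..<r} \<times> {..<p}"

lemma finite_I: "finite I" and card_I: "card I = r * p"
  by (simp_all add: I_def)

lemma offset_less:
  assumes "i \<in> I" "t < s" shows "fst i * t + snd i < 2 * p"
proof -
  have "fst i * t \<le> r * s" using assms by (intro mult_le_mono) (auto simp: I_def)
  then show ?thesis using assms rs by (auto simp: I_def)
qed

lemma slot_coord_range:
  assumes "i \<in> I" "t < s" shows "slot_coord p i t \<in> {1..n}"
proof -
  have "Suc t * (2 * p) \<le> s * (2 * p)" using assms by (intro mult_le_mono) auto
  then show ?thesis using offset_less[OF assms] ps
    by (simp add: slot_coord_def mult_ac)
qed

lemma slot_coord_eqD:
  assumes "i \<in> I" "j \<in> I" "t < s" "t' < s" "slot_coord p i t = slot_coord p j t'"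
  shows "t = t'" "fst i * t + snd i = fst j * t + snd j"
proof -
  have eq: "t * (2 * p) + (fst i * t + snd i) = t' * (2 * p) + (fst j * t' + snd j)"
    using assms(5) by (simp add: slot_coord_def)
  have "(t * (2 * p) + (fst i * t + snd i)) div (2 * p) = t"
    "(t' * (2 * p) + (fst j * t' + snd j)) div (2 * p) = t'"
    using offset_less[OF assms(1,3)] offset_less[OF assms(2,4)] by auto
  then show "t = t'" using eq by simp
  with eq show "fst i * t + snd i = fst j * t + snd j" by simp
qed

text \<open>Lines agreeing at two places have equal slopes, hence equal intercepts.\<close>

lemma slots_share_at_most_one:
  assumes "i \<in> I" "j \<in> I" "i \<noteq> j" "t < s" "t' < s"
    "slot_coord p i t \<in> slot_zeros p s j" "slot_coord p i t' \<in> slot_zeros p s j"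
  shows "t = t'"
proof -
  have eq: "fst i * u + snd i = fst j * u + snd j"
    if u: "u < s" "slot_coord p i u \<in> slot_zeros p s j" for u
  proof -
    obtain u' where "u' < s" "slot_coord p i u = slot_coord p j u'"
      using u(2) by (auto simp: slot_zeros_def)
    then show ?thesis using slot_coord_eqD(2)[OF assms(1,2) u(1)] by blast
  qed
  have "int (fst i) * int t + int (snd i) = int (fst j) * int t + int (snd j)"
    "int (fst i) * int t' + int (snd i) = int (fst j) * int t' + int (snd j)"
    using eq[OF assms(4,6)] eq[OF assms(5,7)] by (metis of_nat_add of_nat_mult)+
  then have "(int (fst i) - int (fst j)) * (int t - int t') = 0"
    by (simp add: algebra_simps)
  then have "fst i = fst j \<or> t = t'" by auto
  moreover have "fst i \<noteq> fst j" using eq[OF assms(4,6)] assms(3) by (auto simp: prod_eq_iff)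
  ultimately show ?thesis by simp
qed

lemma slot_point_zero:
  assumes "i \<in> I" "t < s" shows "slot_point n p s j (slot_coord p i t) \<longleftrightarrow> slot_coord p i t \<notin> slot_zeros p s j"
  using slot_coord_range[OF assms] by (simp add: slot_point_def)

lemma inj_slot_point:
  assumes "s \<ge> 2" shows "inj_on (slot_point n p s) I"
proof (rule inj_onI, rule ccontr)
  fix i j assume ij: "i \<in> I" "j \<in> I" "slot_point n p s i = slot_point n p s j" "i \<noteq> j"
  have "slot_coord p i t \<in> slot_zeros p s j" if "t < s" for t
    using slot_point_zero[OF ij(1) that, of i] slot_point_zero[OF ij(1) that, of j] ij(3) that
    by (auto simp: slot_zeros_def)
  from this[of 0] this[of 1] have "(0::nat) = 1"
    using assms by (intro slots_share_at_most_one[OF ij(1,2,4)]) auto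
  then show False by simp
qed

definition "private A i \<longleftrightarrow> (\<exists>t<s. \<forall>j\<in>A - {i}. slot_coord p i t \<notin> slot_zeros p s j)"

text \<open>Take one private zero of every point labelled false. Within \<open>A\<close>, a chosen
  coordinate is 0 only at its owner, so exactly the points labelled false violate the
  conjunction.\<close>

lemma private_labels_monotone_conjunction:
  assumes A: "A \<subseteq> I" and priv: "\<And>i. i \<in> A \<Longrightarrow> private A i"
  obtains g where "g \<in> monotone_conjunctions n" "\<And>i. i \<in> A \<Longrightarrow> g (slot_point n p s i) = b i"
proof -
  obtain t where t: "\<And>i. i \<in> A \<Longrightarrow> t i < s"
      "\<And>i j. i \<in> A \<Longrightarrow> j \<in> A \<Longrightarrow> j \<noteq> i \<Longrightarrow> slot_coord p i (t i) \<notin> slot_zeros p s j"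
  proof -
    have "\<forall>i. \<exists>t. i \<in> A \<longrightarrow> t < s \<and> (\<forall>j\<in>A - {i}. slot_coord p i t \<notin> slot_zeros p s j)"
      using priv by (auto simp: private_def)
    then obtain t where "\<forall>i. i \<in> A \<longrightarrow> t i < s \<and> (\<forall>j\<in>A - {i}. slot_coord p i (t i) \<notin> slot_zeros p s j)"
      unfolding choice_iff by blast
    then show thesis by (intro that[of t]) auto
  qed
  define E where "E = (\<lambda>i. slot_coord p i (t i)) ` {i \<in> A. \<not> b i}"
  show thesis
  proof (rule that[of "\<lambda>x. \<forall>c\<in>E. x c"])
    have "E \<subseteq> {1..n}" using slot_coord_range t(1) A by (force simp: E_def)
    then show "(\<lambda>x. \<forall>c\<in>E. x c) \<in> monotone_conjunctions n"
      by (auto simp: monotone_conjunctions_def)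
    show "(\<forall>c\<in>E. slot_point n p s i c) = b i" if i: "i \<in> A" for i
    proof -
      have pt: "slot_point n p s i (slot_coord p j (t j)) \<longleftrightarrow> j \<noteq> i" if "j \<in> A" for j
        using slot_point_zero[of j "t j" i] t(1)[OF that] t(2)[OF that i] A that
        by (auto simp: slot_zeros_def)
      show ?thesis
      proof (cases "b i")
        case True
        then show ?thesis using pt by (auto simp: E_def)
      next
        case False
        then have "slot_coord p i (t i) \<in> E" using i by (auto simp: E_def)
        then show ?thesis using pt[OF i] False by auto
      qed
    qed
  qed
qed

end

text \<open>
  A union bound over the choice of one nonzero coordinate in each \<open>B t\<close>; the choices are distinct
  because the \<open>B t\<close> are disjoint.
\<close>

lemma iid_mean_all_hit_le:
  assumes I: "finite I" and J: "finite J" and w: "\<And>x. x \<in> J \<Longrightarrow> w x \<ge> (0::real)" "sum w J = 1"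
    and B: "\<And>t. t < s \<Longrightarrow> B t \<subseteq> I" "\<And>t. t < s \<Longrightarrow> card (B t) \<le> r"
    and disj: "\<And>t t'. t < s \<Longrightarrow> t' < s \<Longrightarrow> t \<noteq> t' \<Longrightarrow> B t \<inter> B t' = {}"
    and \<delta>: "(\<Sum>x\<in>J. w x * of_bool (x \<noteq> 0)) \<le> \<delta>"
  shows "iid_mean I J w (\<lambda>x. of_bool (\<forall>t<s. \<exists>j\<in>B t. x j \<noteq> (0::real))) \<le> (real r * \<delta>) ^ s"
proof -
  let ?F = "PiE {..<s} B"
  have finB: "finite (B t)" if "t < s" for t using B(1)[OF that] I finite_subset by auto
  have \<delta>0: "0 \<le> \<delta>" using w(1) by (intro order.trans[OF sum_nonneg \<delta>]) auto
  have finF: "finite ?F" using finB by (intro finite_PiE) auto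
  have "iid_mean I J w (\<lambda>x. of_bool (\<forall>t<s. \<exists>j\<in>B t. x j \<noteq> 0))
      \<le> iid_mean I J w (\<lambda>x. \<Sum>f\<in>?F. \<Prod>j\<in>f ` {..<s}. of_bool (x j \<noteq> 0))"
  proof (intro iid_mean_mono w)
    fix x :: "'a \<Rightarrow> real"
    show "of_bool (\<forall>t<s. \<exists>j\<in>B t. x j \<noteq> 0) \<le> (\<Sum>f\<in>?F. \<Prod>j\<in>f ` {..<s}. of_bool (x j \<noteq> 0) :: real)"
    proof (cases "\<forall>t<s. \<exists>j\<in>B t. x j \<noteq> 0")
      case True
      then have "\<forall>t. \<exists>j. t < s \<longrightarrow> j \<in> B t \<and> x j \<noteq> 0" by auto
      then obtain f where f: "\<And>t. t < s \<Longrightarrow> f t \<in> B t \<and> x (f t) \<noteq> 0" unfolding choice_iff by auto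
      define g where "g = restrict f {..<s}"
      have g: "g \<in> ?F" using f by (auto simp: g_def)
      have "(\<Prod>j\<in>g ` {..<s}. of_bool (x j \<noteq> 0) :: real) = 1"
        using f by (intro prod.neutral) (auto simp: g_def)
      moreover have "(\<Prod>j\<in>g ` {..<s}. of_bool (x j \<noteq> 0) :: real) \<le> (\<Sum>f\<in>?F. \<Prod>j\<in>f ` {..<s}. of_bool (x j \<noteq> 0))"
        by (rule member_le_sum[OF g _ finF]) (intro prod_nonneg, simp)
      ultimately show ?thesis using True by simp
    next
      case False
      then have "of_bool (\<forall>t<s. \<exists>j\<in>B t. x j \<noteq> 0) = (0::real)" by simp
      also have "\<dots> \<le> (\<Sum>f\<in>?F. \<Prod>j\<in>f ` {..<s}. of_bool (x j \<noteq> 0))"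
        by (intro sum_nonneg prod_nonneg) auto
      finally show ?thesis .
    qed
  qed
  also have "\<dots> = (\<Sum>f\<in>?F. iid_mean I J w (\<lambda>x. \<Prod>j\<in>f ` {..<s}. of_bool (x j \<noteq> 0)))"
    by (rule iid_mean_sum)
  also have "\<dots> \<le> (\<Sum>f\<in>?F. \<delta> ^ s)"
  proof (intro sum_mono)
    fix f assume f: "f \<in> ?F"
    have sub: "f ` {..<s} \<subseteq> I" using f B(1) by (fastforce simp: PiE_iff)
    have inj: "inj_on f {..<s}"
    proof (rule inj_onI, rule ccontr)
      fix t t' assume "t \<in> {..<s}" "t' \<in> {..<s}" "f t = f t'" "t \<noteq> t'"
      then show False using disj[of t t'] PiE_mem[OF f, of t] PiE_mem[OF f, of t'] by auto
    qed
    have "iid_mean I J w (\<lambda>x. \<Prod>j\<in>f ` {..<s}. of_bool (x j \<noteq> 0)) = (\<Sum>x\<in>J. w x * of_bool (x \<noteq> 0)) ^ s"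
      using iid_mean_prod_subset[OF I J w(2) sub, of "\<lambda>_ y. of_bool (y \<noteq> 0)"] inj
      by (simp add: card_image)
    also have "\<dots> \<le> \<delta> ^ s" using \<delta> w(1) by (intro power_mono sum_nonneg) auto
    finally show "iid_mean I J w (\<lambda>x. \<Prod>j\<in>f ` {..<s}. of_bool (x j \<noteq> 0)) \<le> \<delta> ^ s" .
  qed
  also have "\<dots> = real (\<Prod>t<s. card (B t)) * \<delta> ^ s" by (simp add: card_PiE)
  also have "\<dots> \<le> real (r ^ s) * \<delta> ^ s"
  proof -
    have "(\<Prod>t<s. card (B t)) \<le> (\<Prod>t<s. r)" using B(2) by (intro prod_mono) auto
    then have "real (\<Prod>t<s. card (B t)) \<le> real (r ^ s)" by (simp only: of_nat_le_iff prod_constant card_lessThan)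
    then show ?thesis using \<delta>0 by (intro mult_right_mono) auto
  qed
  finally show ?thesis by (simp add: power_mult_distrib)
qed

context slots
begin

lemma iid_mean_not_private_le:
  assumes J: "finite (J :: real set)" and w: "\<And>x. x \<in> J \<Longrightarrow> w x \<ge> (0::real)" "sum w J = 1"
    and \<delta>: "(\<Sum>x\<in>J. w x * of_bool (x \<noteq> 0)) \<le> \<delta>"
  shows "iid_mean I J w (\<lambda>x. of_bool (\<exists>i\<in>I. \<not> private {j\<in>I. x j \<noteq> 0} i)) \<le> real (card I) * (real r * \<delta>) ^ s"
proof -
  let ?P = "\<lambda>x i. of_bool (\<not> private {j\<in>I. x j \<noteq> 0} i) :: real"
  have "iid_mean I J w (\<lambda>x. of_bool (\<exists>i\<in>I. \<not> private {j\<in>I. x j \<noteq> 0} i)) \<le> iid_mean I J w (\<lambda>x. \<Sum>i\<in>I. ?P x i)"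
  proof (intro iid_mean_mono w)
    fix x :: "nat \<times> nat \<Rightarrow> real"
    show "of_bool (\<exists>i\<in>I. \<not> private {j\<in>I. x j \<noteq> 0} i) \<le> (\<Sum>i\<in>I. ?P x i)"
    proof (cases "\<exists>i\<in>I. \<not> private {j\<in>I. x j \<noteq> 0} i")
      case True
      then obtain i where "i \<in> I" "\<not> private {j\<in>I. x j \<noteq> 0} i" by auto
      then show ?thesis using member_le_sum[of i I "?P x"] finite_I by auto
    next
      case False
      then have "of_bool (\<exists>i\<in>I. \<not> private {j\<in>I. x j \<noteq> 0} i) = (0::real)" by simp
      also have "\<dots> \<le> (\<Sum>i\<in>I. ?P x i)" by (intro sum_nonneg) auto
      finally show ?thesis .
    qed
  qed
  also have "\<dots> = (\<Sum>i\<in>I. iid_mean I J w (\<lambda>x. ?P x i))" by (rule iid_mean_sum)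
  also have "\<dots> \<le> (\<Sum>i\<in>I. (real r * \<delta>) ^ s)"
  proof (intro sum_mono)
    fix i assume i: "i \<in> I"
    \<comment> \<open>These are the lines that cross line \<open>i\<close> in block
      \<open>t\<close>, at most one for each slope. Slot \<open>i\<close> fails to be private
      exactly if every \<open>B t\<close> contains a slot of nonzero weight.\<close>
    define B where "B t = {j \<in> I - {i}. slot_coord p i t \<in> slot_zeros p s j}" for t
    have hit: "(\<exists>j\<in>B t. x j \<noteq> 0)
        \<longleftrightarrow> (\<exists>j\<in>{j\<in>I. x j \<noteq> 0} - {i}. slot_coord p i t \<in> slot_zeros p s j)"
      for x :: "nat \<times> nat \<Rightarrow> real" and t
      unfolding B_def by blast
    have "iid_mean I J w (\<lambda>x. ?P x i) = iid_mean I J w (\<lambda>x. of_bool (\<forall>t<s. \<exists>j\<in>B t. x j \<noteq> 0))"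
      unfolding hit private_def by (intro iid_mean_cong) simp
    also have "\<dots> \<le> (real r * \<delta>) ^ s"
    proof (rule iid_mean_all_hit_le[OF finite_I J w _ _ _ \<delta>])
      show "B t \<subseteq> I" for t by (auto simp: B_def)
      show "card (B t) \<le> r" if t: "t < s" for t
      proof -
        have eq: "fst i * t + snd i = fst j * t + snd j" if "j \<in> B t" for j
        proof -
          obtain u where "u < s" "slot_coord p i t = slot_coord p j u" "j \<in> I"
            using \<open>j \<in> B t\<close> by (auto simp: B_def slot_zeros_def)
          then show ?thesis using slot_coord_eqD(2)[OF i _ t] by blast
        qed
        have "inj_on fst (B t)"
        proof (rule inj_onI)
          fix j k assume "j \<in> B t" "k \<in> B t" "fst j = fst k"
          then show "j = k" using eq[of j] eq[of k] by (simp add: prod_eq_iff)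
        qed
        moreover have "fst ` B t \<subseteq> {..<r}" by (auto simp: B_def I_def)
        ultimately show ?thesis using card_inj_on_le[of fst "B t" "{..<r}"] by simp
      qed
      show "B t \<inter> B t' = {}" if "t < s" "t' < s" "t \<noteq> t'" for t t'
        using slots_share_at_most_one[OF i] that by (auto simp: B_def)
    qed auto
    finally show "iid_mean I J w (\<lambda>x. ?P x i) \<le> (real r * \<delta>) ^ s" .
  qed
  finally show ?thesis by simp
qed

end

section \<open>Hard labellings\<close>

lemma pmf_of_weights:
  fixes lam :: "'i \<Rightarrow> real"
  assumes I: "finite I" and nn: "\<And>i. i \<in> I \<Longrightarrow> lam i \<ge> 0" and pos: "sum lam I > 0"
  obtains P where "\<And>i. pmf P i = (if i \<in> I then lam i / sum lam I else 0)"
proof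
  let ?f = "\<lambda>i. if i \<in> I then lam i / sum lam I else 0"
  show "pmf (embed_pmf ?f) i = ?f i" for i
  proof (rule pmf_embed_pmf)
    show "0 \<le> ?f x" for x using nn pos by auto
    have "(\<integral>\<^sup>+ x. ennreal (?f x) \<partial>count_space UNIV) = (\<Sum>x\<in>I. ennreal (?f x))"
      using I by (intro nn_integral_count_space') auto
    also have "\<dots> = ennreal (\<Sum>x\<in>I. ?f x)" using nn pos by (intro sum_ennreal) auto
    also have "(\<Sum>x\<in>I. ?f x) = 1" using pos by (simp flip: sum_divide_distrib)
    finally show "(\<integral>\<^sup>+ x. ennreal (?f x) \<partial>count_space UNIV) = 1" by simp
  qed
qed

lemma accept_mean_eq_pmf:
  assumes I: "finite I" and P: "\<And>i. pmf P i = (if i \<in> I then lam i / S else 0)"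
  shows "pmf (bind_pmf (replicate_pmf q P) (\<lambda>v. A (h @ v))) True
       = accept_mean I (\<lambda>h. pmf (A h) True) lam S q h"
proof (induction q arbitrary: h)
  case 0
  then show ?case by (simp add: bind_return_pmf)
next
  case (Suc q)
  have "bind_pmf (replicate_pmf (Suc q) P) (\<lambda>v. A (h @ v))
      = bind_pmf P (\<lambda>i. bind_pmf (replicate_pmf q P) (\<lambda>v. A ((h @ [i]) @ v)))"
    by (simp add: bind_assoc_pmf bind_return_pmf)
  also have "pmf \<dots> True = (\<Sum>i\<in>I. pmf (bind_pmf (replicate_pmf q P) (\<lambda>v. A ((h @ [i]) @ v))) True * pmf P i)"
    unfolding pmf_bind[of P] using I P
    by (intro integral_measure_pmf_real) (auto simp: set_pmf_iff split: if_splits)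
  also have "\<dots> = accept_mean I (\<lambda>h. pmf (A h) True) lam S (Suc q) h"
    unfolding Suc.IH by (simp add: P mult.commute)
  finally show ?case .
qed

lemma replicate_pmf_map: "replicate_pmf q (map_pmf f P) = map_pmf (map f) (replicate_pmf q P)"
  by (induction q) (simp_all add: map_bind_pmf bind_map_pmf)

lemma run_on_samples_map:
  "run_on_samples q T (map_pmf pt P) f
     = bind_pmf (replicate_pmf q P) (\<lambda>v. T (map (\<lambda>i. (pt i, f (pt i))) v))"
  by (simp add: run_on_samples_def replicate_pmf_map bind_map_pmf comp_def)

lemma run_on_samples_cong:
  assumes "\<And>x. x \<in> set_pmf D \<Longrightarrow> f x = g x"
  shows "run_on_samples q T D f = run_on_samples q T D g"
  unfolding run_on_samples_def
proof (intro bind_pmf_cong refl arg_cong[where f = T] map_cong)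
  fix zs z assume "zs \<in> set_pmf (replicate_pmf q D)" "z \<in> set zs"
  then show "(z, f z) = (z, g z)" using assms by (auto simp: set_replicate_pmf)
qed

text \<open>Values outside the cube are arbitrary, so \<open>decision_lists n\<close> itself is
  infinite; hence the restriction to \<open>X\<close>. The bound counts the choices of \<pi>, \<mu>
  and \<nu>.\<close>

lemma card_decision_list_patterns:
  assumes "X \<subseteq> cube n"
  shows "finite ((\<lambda>g. restrict g X) ` decision_lists n)"
    and "card ((\<lambda>g. restrict g X) ` decision_lists n) \<le> fact n * 2 ^ n * 2 ^ (n + 1)"
proof -
  let ?Q = "{\<pi>. \<pi> permutes {1..n}} \<times> cube n \<times> cube (n + 1)"
  have fin_cube: "finite (cube k)" for k by (simp add: cube_def finite_PiE)
  have card_cube: "card (cube k) = 2 ^ k" for k by (simp add: cube_def card_PiE)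
  have fin: "finite ?Q" using finite_permutations[of "{1..n}"] fin_cube by (intro finite_cartesian_product) auto
  have card: "card ?Q = fact n * 2 ^ n * 2 ^ (n + 1)"
    using card_permutations[of "{1..n}" n] by (simp add: card_cartesian_product card_cube)
  have sub: "(\<lambda>g. restrict g X) ` decision_lists n \<subseteq> (\<lambda>(\<pi>, \<mu>, \<nu>). restrict (eval_dl n \<pi> \<mu> \<nu>) X) ` ?Q"
  proof
    fix h assume "h \<in> (\<lambda>g. restrict g X) ` decision_lists n"
    then obtain g where g: "g \<in> decision_lists n" "h = restrict g X" by auto
    then obtain \<pi> \<mu> \<nu> where q: "(\<pi>, \<mu>, \<nu>) \<in> ?Q" "\<forall>x\<in>cube n. g x = eval_dl n \<pi> \<mu> \<nu> x"
      by (auto simp: decision_lists_def)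
    then have "h = restrict (eval_dl n \<pi> \<mu> \<nu>) X" using g(2) assms by (auto simp: restrict_def)
    with q(1) show "h \<in> (\<lambda>(\<pi>, \<mu>, \<nu>). restrict (eval_dl n \<pi> \<mu> \<nu>) X) ` ?Q" by (intro image_eqI) auto
  qed
  show "finite ((\<lambda>g. restrict g X) ` decision_lists n)"
    using finite_subset[OF sub] fin by blast
  show "card ((\<lambda>g. restrict g X) ` decision_lists n) \<le> fact n * 2 ^ n * 2 ^ (n + 1)"
    using order.trans[OF card_mono[OF finite_imageI[OF fin] sub] card_image_le[OF fin]] unfolding card .
qed

lemma of_bool_ex_le_sum: 
  assumes "finite A" shows "of_bool (\<exists>a\<in>A. P a) \<le> (\<Sum>a\<in>A. of_bool (P a) :: real)"
proof (cases "\<exists>a\<in>A. P a")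
  case True
  then obtain a where "a \<in> A" "P a" by blast
  then show ?thesis using member_le_sum[of a A "\<lambda>a. of_bool (P a) :: real"] assms by auto
qed (simp add: sum_nonneg)

lemma exp_minus_one_le_half: "exp (- 1 :: real) \<le> 1 / 2"
  using exp_ge_add_one_self[of "1::real"] by (simp add: exp_minus field_simps)

text \<open>Chernoff bound over random labels and weights together. A slot whose label differs from
  \<open>g\<close> contributes a factor of mean at most 1 - 2/5 * 1/2 = 4/5, any other slot the
  factor 1. Averaging over the label gives 9/10, at most exp(-1/10), against exp(1/20) per slot from
  the threshold.\<close>

lemma iid_mean_few_light_mismatches:
  fixes J :: "real set" and g :: "'i \<Rightarrow> bool"
  assumes I: "finite I" and J: "finite J" "1 \<in> J"
    and w: "\<And>x. x \<in> J \<Longrightarrow> w x \<ge> 0" "sum w J = 1" "w 1 \<ge> 2/5"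
  shows "iid_mean I UNIV (\<lambda>_. 1/2) (\<lambda>b. iid_mean I J w (\<lambda>lam.
           of_bool (real (card {i\<in>I. lam i = 1 \<and> b i \<noteq> g i}) < real (card I) / 20)))
       \<le> exp (- real (card I) / 20)"
proof -
  let ?N = "real (card I)"
  have inner: "iid_mean I J w (\<lambda>lam. of_bool (real (card {i\<in>I. lam i = 1 \<and> b i \<noteq> g i}) < ?N / 20))
      \<le> exp (?N / 20) * (\<Prod>i\<in>I. if b i \<noteq> g i then 4/5 else 1)" for b
  proof -
    have "iid_mean I J w (\<lambda>lam. of_bool (real (card {i\<in>I. lam i = 1 \<and> b i \<noteq> g i}) < ?N / 20))
       \<le> iid_mean I J w (\<lambda>lam. exp (?N / 20) * (\<Prod>i\<in>I. if lam i = 1 \<and> b i \<noteq> g i then exp (- 1) else 1))"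
    proof (intro iid_mean_mono w)
      fix lam :: "'i \<Rightarrow> real"
      let ?c = "card {i\<in>I. lam i = 1 \<and> b i \<noteq> g i}"
      have "(\<Prod>i\<in>I. if lam i = 1 \<and> b i \<noteq> g i then exp (- 1) else 1 :: real) = exp (- 1) ^ ?c"
        using I by (simp add: prod.If_cases Int_def)
      also have "\<dots> = exp (- real ?c)" by (simp flip: exp_of_nat_mult)
      finally have P: "(\<Prod>i\<in>I. if lam i = 1 \<and> b i \<noteq> g i then exp (- 1) else 1 :: real) = exp (- real ?c)" .
      have "of_bool (real ?c < ?N / 20) \<le> exp (?N / 20 + - real ?c)"
        by (cases "real ?c < ?N / 20") simp_all
      then show "of_bool (real ?c < ?N / 20) \<le> exp (?N / 20) * (\<Prod>i\<in>I. if lam i = 1 \<and> b i \<noteq> g i then exp (- 1) else 1)"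
        unfolding P exp_add .
    qed
    also have "\<dots> = exp (?N / 20) * (\<Prod>i\<in>I. \<Sum>y\<in>J. w y * (if y = 1 \<and> b i \<noteq> g i then exp (- 1) else 1))"
      unfolding iid_mean_cmult
      by (subst iid_mean_prod[OF I J(1), where f = "\<lambda>i y. if y = 1 \<and> b i \<noteq> g i then exp (- 1) else 1"]) simp
    also have "\<dots> \<le> exp (?N / 20) * (\<Prod>i\<in>I. if b i \<noteq> g i then 4/5 else 1)"
    proof (intro mult_left_mono prod_mono conjI)
      fix i
      show "0 \<le> (\<Sum>y\<in>J. w y * (if y = 1 \<and> b i \<noteq> g i then exp (- 1) else 1))"
        using w(1) by (intro sum_nonneg) auto
      have "(\<Sum>y\<in>J. w y * (if y = 1 then exp (- 1) else 1)) = 1 - w 1 * (1 - exp (- 1))"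
      proof -
        have "(\<Sum>y\<in>J. w y * (if y = 1 then exp (- 1) else 1)) = w 1 * exp (-1) + sum w (J - {1})"
          using J by (subst sum.remove[of _ 1]) auto
        also have "sum w (J - {1}) = 1 - w 1" using J w(2) by (simp add: sum_diff1)
        finally show ?thesis by (simp add: algebra_simps)
      qed
      also have "\<dots> \<le> 1 - 2/5 * (1/2)"
        using w(3) exp_minus_one_le_half by (intro diff_left_mono mult_mono) auto
      finally have "(\<Sum>y\<in>J. w y * (if y = 1 then exp (- 1) else 1)) \<le> 4/5" by simp
      then show "(\<Sum>y\<in>J. w y * (if y = 1 \<and> b i \<noteq> g i then exp (- 1) else 1)) \<le> (if b i \<noteq> g i then 4/5 else 1)"
        using w(2) by simp
    qed simp
    finally show ?thesis .
  qed
  have "iid_mean I UNIV (\<lambda>_. 1/2) (\<lambda>b. iid_mean I J w (\<lambda>lam.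
           of_bool (real (card {i\<in>I. lam i = 1 \<and> b i \<noteq> g i}) < ?N / 20)))
      \<le> iid_mean I UNIV (\<lambda>_. 1/2) (\<lambda>b. exp (?N / 20) * (\<Prod>i\<in>I. if b i \<noteq> g i then 4/5 else 1))"
    by (intro iid_mean_mono inner) auto
  also have "\<dots> = exp (?N / 20) * (\<Prod>i\<in>I. \<Sum>y\<in>UNIV. 1/2 * (if y \<noteq> g i then 4/5 else 1))"
    unfolding iid_mean_cmult
    by (subst iid_mean_prod[OF I finite, where f = "\<lambda>i y. if y \<noteq> g i then 4/5 else 1"]) simp
  also have "(\<Prod>i\<in>I. \<Sum>y\<in>UNIV. 1/2 * (if y \<noteq> g i then 4/5 else 1)) = (1 - 1/10 :: real) ^ card I"
  proof -
    have "(\<Sum>y\<in>UNIV. 1/2 * (if y \<noteq> g i then 4/5 else 1)) = (1 - 1/10 :: real)" for i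
      by (cases "g i") (simp_all add: UNIV_bool)
    then show ?thesis by (simp only: prod_constant)
  qed
  also have "exp (?N / 20) * \<dots> \<le> exp (?N / 20) * exp (- (1/10)) ^ card I"
    using exp_ge_add_one_self[of "- (1/10) :: real"] by (intro mult_left_mono power_mono) auto
  also have "\<dots> = exp (- ?N / 20)"
    by (simp flip: exp_of_nat_mult exp_add)
  finally show ?thesis .
qed

text \<open>Uniform labels satisfy the bound on average, so the best labelling satisfies it.\<close>

lemma exists_hard_labels:
  fixes J :: "real set" and G :: "('i \<Rightarrow> bool) set"
  assumes I: "finite I" and J: "finite J" "1 \<in> J"
    and w: "\<And>x. x \<in> J \<Longrightarrow> w x \<ge> 0" "sum w J = 1" "w 1 \<ge> 2/5"
    and G: "finite G"
  obtains b where "iid_mean I J w (\<lambda>lam.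
      of_bool (\<exists>g\<in>G. real (card {i\<in>I. lam i = 1 \<and> b i \<noteq> g i}) < real (card I) / 20))
    \<le> real (card G) * exp (- real (card I) / 20)"
proof -
  define F where "F b = iid_mean I J w (\<lambda>lam.
      of_bool (\<exists>g\<in>G. real (card {i\<in>I. lam i = 1 \<and> b i \<noteq> g i}) < real (card I) / 20))" for b
  let ?B = "I \<rightarrow>\<^sub>E (UNIV :: bool set)"
  have fin: "finite (F ` ?B)" using I by (intro finite_imageI finite_PiE) auto
  have ne: "F ` ?B \<noteq> {}" by (simp add: PiE_eq_empty_iff)
  obtain b where b: "F b = Min (F ` ?B)" using Min_in[OF fin ne] by auto
  have "F b = iid_mean I (UNIV :: bool set) (\<lambda>_. 1/2) (\<lambda>_. F b)"
    using I by (subst iid_mean_const) auto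
  also have "\<dots> \<le> iid_mean I UNIV (\<lambda>_. 1/2) F"
    using fin by (intro iid_mean_mono) (auto simp: b)
  also have "\<dots> \<le> iid_mean I UNIV (\<lambda>_. 1/2) (\<lambda>b. \<Sum>g\<in>G. iid_mean I J w (\<lambda>lam.
           of_bool (real (card {i\<in>I. lam i = 1 \<and> b i \<noteq> g i}) < real (card I) / 20)))"
    unfolding F_def iid_mean_sum[symmetric] by (intro iid_mean_mono w of_bool_ex_le_sum G) auto
  also have "\<dots> \<le> (\<Sum>g\<in>G. exp (- real (card I) / 20))"
    unfolding iid_mean_sum by (intro sum_mono iid_mean_few_light_mismatches assms)
  finally show thesis using that by (simp add: F_def)
qed

section \<open>The lower bound for one tester\<close>

definition tester_value ::
  "('i \<Rightarrow> nat \<Rightarrow> bool) \<Rightarrow> ((nat \<Rightarrow> bool) \<Rightarrow> bool) \<Rightarrow> sample_algorithm \<Rightarrow> 'i list \<Rightarrow> real" where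
  "tester_value pt f T h = pmf (T (map (\<lambda>i. (pt i, f (pt i))) h)) True"

lemma rejection_mean_eq_run:
  fixes lam :: "'i \<Rightarrow> real" and \<Lambda> :: real
  assumes I: "finite I" "I \<noteq> {}" and lam: "\<And>i. i \<in> I \<Longrightarrow> 0 \<le> lam i \<and> lam i \<le> \<Lambda>" and \<Lambda>: "\<Lambda> > 0"
    and pos: "sum lam I > 0"
  obtains P sh where "\<And>i. pmf P i = (if i \<in> I then lam i / sum lam I else 0)"
    "rejection_mean I (tester_value pt f T) \<Lambda> lam R q []
       = (1 - sh) * pmf (run_on_samples q T (map_pmf pt P) f) True + sh"
    "0 \<le> sh" "sh \<le> 1" "sh \<le> 2 ^ q * (1 - sum lam I / (\<Lambda> * card I) / 2) ^ R"
proof -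
  obtain P where P: "\<And>i. pmf P i = (if i \<in> I then lam i / sum lam I else 0)"
    using pmf_of_weights[OF I(1) _ pos] lam by blast
  let ?a = "sum lam I / (\<Lambda> * card I)"
  have a: "0 \<le> ?a" "?a \<le> 1"
  proof -
    show "0 \<le> ?a" using pos \<Lambda> by simp
    have "sum lam I \<le> card I * \<Lambda>" using sum_bounded_above[of I lam \<Lambda>] lam by simp
    then show "?a \<le> 1" using \<Lambda> I by (simp add: divide_le_eq card_gt_0_iff mult.commute)
  qed
  have "accept_mean I (tester_value pt f T) lam (sum lam I) q []
      = pmf (run_on_samples q T (map_pmf pt P) f) True"
    using accept_mean_eq_pmf[OF I(1) P, of q "\<lambda>h. T (map (\<lambda>i. (pt i, f (pt i))) h)" "[]"]
    by (simp add: run_on_samples_map tester_value_def[abs_def])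
  then have eq: "rejection_mean I (tester_value pt f T) \<Lambda> lam R q []
      = (1 - shortage ?a R q) * pmf (run_on_samples q T (map_pmf pt P) f) True + shortage ?a R q"
    using rejection_mean_eq[OF I, where lam = lam and \<Lambda> = \<Lambda> and \<tau> = "tester_value pt f T"
        and R = R and q = q and h = "[]"] lam \<Lambda> by simp
  from that[OF P eq] show thesis using shortage_bounds[OF a, of R q] by blast
qed

context slots
begin

text \<open>On the support the labels agree with a monotone conjunction, so the tester accepts. A
  shortage of any probability sh is harmless here, because (1 - sh) * 2/3 + sh is at least
  2/3.\<close>

lemma rejection_mean_private_ge:
  fixes lam :: "nat \<times> nat \<Rightarrow> real" and \<Lambda> :: real
  assumes ne: "I \<noteq> {}" and lam: "\<And>i. i \<in> I \<Longrightarrow> 0 \<le> lam i \<and> lam i \<le> \<Lambda>" and \<Lambda>: "\<Lambda> > 0"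
    and acc: "\<And>D f. set_pmf D \<subseteq> cube n \<Longrightarrow> f \<in> monotone_conjunctions n
                \<Longrightarrow> pmf (run_on_samples q T D f) True \<ge> 2/3"
    and priv: "\<And>i. i \<in> I \<Longrightarrow> private {j\<in>I. lam j \<noteq> 0} i"
  shows "rejection_mean I (tester_value (slot_point n p s) f T) \<Lambda> lam R q [] \<ge> 2/3"
proof (cases "sum lam I > 0")
  case True
  let ?pt = "slot_point n p s"
  obtain P sh where P: "\<And>i. pmf P i = (if i \<in> I then lam i / sum lam I else 0)"
    and eq: "rejection_mean I (tester_value ?pt f T) \<Lambda> lam R q []
       = (1 - sh) * pmf (run_on_samples q T (map_pmf ?pt P) f) True + sh"
    and sh: "0 \<le> sh" "sh \<le> 1" "sh \<le> 2 ^ q * (1 - sum lam I / (\<Lambda> * card I) / 2) ^ R"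
    by (rule rejection_mean_eq_run[OF finite_I ne lam \<Lambda> True, where pt = ?pt and f = f and T = T and R = R and q = q]; blast)
  obtain g where g: "g \<in> monotone_conjunctions n"
      "\<And>i. i \<in> {j\<in>I. lam j \<noteq> 0} \<Longrightarrow> g (?pt i) = f (?pt i)"
    by (rule private_labels_monotone_conjunction[of "{j\<in>I. lam j \<noteq> 0}" "\<lambda>i. f (?pt i)"]) (use priv in auto)
  have "set_pmf P \<subseteq> {j\<in>I. lam j \<noteq> 0}" using P by (auto simp: set_pmf_iff split: if_splits)
  then have "run_on_samples q T (map_pmf ?pt P) f = run_on_samples q T (map_pmf ?pt P) g"
    using g(2) by (intro run_on_samples_cong) auto
  moreover have "set_pmf (map_pmf ?pt P) \<subseteq> cube n" using slot_point_in_cube by auto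
  ultimately have "pmf (run_on_samples q T (map_pmf ?pt P) f) True \<ge> 2/3"
    using acc[OF _ g(1)] by simp
  then have "(1 - sh) * (2/3) \<le> (1 - sh) * pmf (run_on_samples q T (map_pmf ?pt P) f) True"
    using sh by (intro mult_left_mono) auto
  moreover have "2/3 \<le> (1 - sh) * (2/3) + sh" using sh(1) by (simp add: field_simps)
  ultimately show ?thesis unfolding eq by linarith
next
  case False
  \<comment> \<open>Now all weights are 0 and no proposal is ever kept: for \<open>q > 0\<close> the
    run accepts by shortage.\<close>
  then have S: "sum lam I = 0" using sum_nonneg[of I lam] lam by force
  note eq = rejection_mean_eq[OF finite_I ne, where lam = lam and \<Lambda> = \<Lambda>
      and \<tau> = "tester_value (slot_point n p s) f T" and R = R and q = q and h = "[]"]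
  show ?thesis
  proof (cases "q = 0")
    case True
    \<comment> \<open>Without samples the tester cannot see the function, so it answers as for the
      constant 1.\<close>
    have "(\<lambda>_. True) \<in> monotone_conjunctions n" by (auto simp: monotone_conjunctions_def)
    moreover obtain i where "i \<in> I" using ne by auto
    ultimately have "pmf (run_on_samples q T (return_pmf (slot_point n p s i)) (\<lambda>_. True)) True \<ge> 2/3"
      using slot_point_in_cube by (intro acc) auto
    then show ?thesis
      by (simp add: True run_on_samples_def bind_return_pmf tester_value_def)
  next
    case False
    then show ?thesis using eq lam \<Lambda> S by (simp add: shortage_zero)
  qed
qed

lemma rejection_mean_hard_le:
  fixes lam :: "nat \<times> nat \<Rightarrow> real" and \<Lambda> :: real
  assumes ne: "I \<noteq> {}" and lam: "\<And>i. i \<in> I \<Longrightarrow> 0 \<le> lam i \<and> lam i \<le> \<Lambda>" and \<Lambda>: "\<Lambda> > 0"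
    and rej: "\<And>D f. set_pmf D \<subseteq> cube n \<Longrightarrow> far_from (1/200) D (decision_lists n) f
                \<Longrightarrow> pmf (run_on_samples q T D f) False \<ge> 2/3"
    and hard: "\<And>g. g \<in> decision_lists n \<Longrightarrow>
       real (card {i\<in>I. lam i = 1 \<and> f (slot_point n p s i) \<noteq> g (slot_point n p s i)}) \<ge> real (card I) / 20"
    and S: "sum lam I \<le> 10 * real (card I)"
    and q: "real q \<le> real (card I) / (80 * \<Lambda>)" and large: "real (card I) / (80 * \<Lambda>) \<ge> 5"
  shows "rejection_mean I (tester_value (slot_point n p s) f T) \<Lambda> lam (card I) q [] \<le> 1/3 + 1/20"
proof -
  let ?pt = "slot_point n p s" and ?N = "real (card I)" and ?S = "sum lam I"
  have N: "?N > 0" using ne finite_I by (simp add: card_gt_0_iff)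
  have S_ge: "?S \<ge> real (card {i\<in>I. lam i = 1 \<and> B i})" for B
  proof -
    have "real (card {i\<in>I. lam i = 1 \<and> B i}) = (\<Sum>i\<in>{i\<in>I. lam i = 1 \<and> B i}. lam i)" by simp
    also have "\<dots> \<le> ?S" using lam finite_I by (intro sum_mono2) auto
    finally show ?thesis .
  qed
  \<comment> \<open>Any decision list serves here: its mismatches have weight 1 each, so
    \<open>hard\<close> bounds the total weight from below.\<close>
  have "(\<lambda>x. eval_dl n id (\<lambda>_\<in>{1..n}. True) (\<lambda>_\<in>{1..n+1}. True) x) \<in> decision_lists n"
    unfolding decision_lists_def mem_Collect_eq
    by (intro exI[of _ id] exI[of _ "\<lambda>_\<in>{1..n}. True"] exI[of _ "\<lambda>_\<in>{1..n+1}. True"])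
       (auto simp: cube_def permutes_id)
  from order.trans[OF hard[OF this] S_ge] have S20: "?S \<ge> ?N / 20" .
  then have S_pos: "?S > 0" using N by simp
  obtain P sh where P: "\<And>i. pmf P i = (if i \<in> I then lam i / sum lam I else 0)"
    and eq: "rejection_mean I (tester_value ?pt f T) \<Lambda> lam (card I) q []
       = (1 - sh) * pmf (run_on_samples q T (map_pmf ?pt P) f) True + sh"
    and sh: "0 \<le> sh" "sh \<le> 1" "sh \<le> 2 ^ q * (1 - sum lam I / (\<Lambda> * card I) / 2) ^ card I"
    by (rule rejection_mean_eq_run[OF finite_I ne lam \<Lambda> S_pos, where pt = ?pt and f = f and T = T and R = "card I" and q = q]; blast)
  have "far_from (1/200) (map_pmf ?pt P) (decision_lists n) f"
    unfolding far_from_def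
  proof
    fix g assume g: "g \<in> decision_lists n"
    let ?M = "{i\<in>I. lam i = 1 \<and> f (?pt i) \<noteq> g (?pt i)}"
    have "1/200 \<le> (?N / 20) / ?S" using S S_pos by (simp add: field_simps)
    also have "\<dots> \<le> real (card ?M) / ?S" using hard[OF g] S_pos by (intro divide_right_mono) auto
    also have "\<dots> = measure_pmf.prob P ?M"
      using finite_I by (simp add: measure_measure_pmf_finite P)
    also have "\<dots> \<le> measure_pmf.prob P {i. f (?pt i) \<noteq> g (?pt i)}"
      by (intro measure_pmf.finite_measure_mono) auto
    also have "\<dots> = measure_pmf.prob (map_pmf ?pt P) {x. f x \<noteq> g x}" by (simp add: vimage_def)
    finally show "1/200 \<le> measure_pmf.prob (map_pmf ?pt P) {x. f x \<noteq> g x}" .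
  qed
  then have "pmf (run_on_samples q T (map_pmf ?pt P) f) False \<ge> 2/3"
    using slot_point_in_cube by (intro rej) auto
  then have acc: "pmf (run_on_samples q T (map_pmf ?pt P) f) True \<le> 1/3"
    by (simp add: pmf_False_conv_True)
  have "sh \<le> 1/20"
  proof -
    \<comment> \<open>The mean number of kept proposals is at least N / (20 \<Lambda>), four times
      the bound on \<open>q\<close>. The two factors of the shortage bound leave exp(- N / (80
      \<Lambda>)), at most exp(-5).\<close>
    let ?a = "?S / (\<Lambda> * card I)"
    have a_ge: "?a \<ge> 1 / (20 * \<Lambda>)" using S20 N \<Lambda> by (simp add: field_simps)
    have a_le: "?a \<le> 1"
      using sum_bounded_above[of I lam \<Lambda>] lam N \<Lambda> by (simp add: divide_le_eq mult.commute)
    have "(1 - ?a / 2) ^ card I \<le> (1 - 1 / (40 * \<Lambda>)) ^ card I"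
      using a_ge a_le by (intro power_mono) auto
    also have "\<dots> \<le> exp (- 1 / (40 * \<Lambda>)) ^ card I"
    proof (intro power_mono)
      show "1 - 1 / (40 * \<Lambda>) \<le> exp (- 1 / (40 * \<Lambda>))"
        using exp_ge_add_one_self[of "- 1 / (40 * \<Lambda>)"] by simp
      show "0 \<le> 1 - 1 / (40 * \<Lambda>)" using a_ge a_le by simp
    qed
    also have "\<dots> = exp (- 2 * (?N / (80 * \<Lambda>)))" by (simp flip: exp_of_nat_mult)
    finally have A: "(1 - ?a / 2) ^ card I \<le> exp (- 2 * (?N / (80 * \<Lambda>)))" .
    have "(2::real) ^ q \<le> exp 1 ^ q"
      using exp_ge_add_one_self[of "1::real"] by (intro power_mono) auto
    also have "\<dots> = exp (real q)" by (simp flip: exp_of_nat_mult)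
    also have "\<dots> \<le> exp (?N / (80 * \<Lambda>))" using q by simp
    finally have B: "(2::real) ^ q \<le> exp (?N / (80 * \<Lambda>))" .
    have "sh \<le> exp (?N / (80 * \<Lambda>)) * exp (- 2 * (?N / (80 * \<Lambda>)))"
      using a_le by (intro order.trans[OF sh(3)] mult_mono A B) auto
    also have "\<dots> = exp (- (?N / (80 * \<Lambda>)))" by (simp flip: exp_add)
    also have "\<dots> \<le> exp (real 5 * - 1)" using large by simp
    also have "\<dots> = exp (- 1) ^ 5" by (rule exp_of_nat_mult)
    also have "\<dots> \<le> (1/2) ^ 5" by (intro power_mono exp_minus_one_le_half) auto
    also have "\<dots> \<le> 1/20" by (simp add: eval_nat_numeral)
    finally show ?thesis .
  qed
  moreover have "(1 - sh) * pmf (run_on_samples q T (map_pmf ?pt P) f) True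
      \<le> 1 * pmf (run_on_samples q T (map_pmf ?pt P) f) True"
    using sh by (intro mult_right_mono) auto
  ultimately show ?thesis unfolding eq using acc by simp
qed

lemma rejection_mean_le_one:
  fixes lam :: "nat \<times> nat \<Rightarrow> real" and \<Lambda> :: real
  assumes ne: "I \<noteq> {}" and lam: "\<And>i. i \<in> I \<Longrightarrow> 0 \<le> lam i \<and> lam i \<le> \<Lambda>" and \<Lambda>: "\<Lambda> > 0"
    and S: "sum lam I > 0"
  shows "rejection_mean I (tester_value pt f T) \<Lambda> lam R q [] \<le> 1"
proof -
  obtain P sh where "\<And>i. pmf P i = (if i \<in> I then lam i / sum lam I else 0)"
    and eq: "rejection_mean I (tester_value pt f T) \<Lambda> lam R q []
       = (1 - sh) * pmf (run_on_samples q T (map_pmf pt P) f) True + sh"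
    and sh: "0 \<le> sh" "sh \<le> 1" "sh \<le> 2 ^ q * (1 - sum lam I / (\<Lambda> * card I) / 2) ^ R"
    by (rule rejection_mean_eq_run[OF finite_I ne lam \<Lambda> S, where pt = pt and f = f and T = T and R = R and q = q]; blast)
  have "(1 - sh) * pmf (run_on_samples q T (map_pmf pt P) f) True \<le> (1 - sh) * 1"
    using sh by (intro mult_left_mono pmf_le_1) auto
  then show ?thesis unfolding eq by simp
qed

text \<open>Error budget: the mean acceptance is at least 2/3 - 1/100 under \<open>w\<close> and at
  most 1/3 + 1/20 + 1/100 + 1/10 under \<open>w'\<close>, while the former can exceed the latter by
  at most 1/100.\<close>

lemma sample_lower_bound:
  fixes m :: nat
  defines "N \<equiv> real (r * p)" and "\<Lambda> \<equiv> 1 + 4 * real r * real m ^ 4"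
  assumes s: "s \<ge> 2" and rp: "r \<ge> 1" "p \<ge> 1" and m: "m \<ge> 1"
    and acc: "\<And>D f. set_pmf D \<subseteq> cube n \<Longrightarrow> f \<in> monotone_conjunctions n
                \<Longrightarrow> pmf (run_on_samples q T D f) True \<ge> 2/3"
    and rej: "\<And>D f. set_pmf D \<subseteq> cube n \<Longrightarrow> far_from (1/200) D (decision_lists n) f
                \<Longrightarrow> pmf (run_on_samples q T D f) False \<ge> 2/3"
    and privacy: "N * (1/4) ^ s \<le> 1/100"
    and labels: "real (fact n * 2 ^ n * 2 ^ (n + 1)) * exp (- N / 20) \<le> 1/100"
    and load: "3 * N / 2 ^ Suc m \<le> 1/100"
    and large: "N / (80 * \<Lambda>) \<ge> 5"
  shows "real q \<ge> N / (80 * \<Lambda>)"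
proof (rule ccontr)
  assume "\<not> ?thesis"
  then have q: "real q \<le> N / (80 * \<Lambda>)" by simp
  have N: "real (card I) = N" by (simp add: card_I N_def)
  have ne: "I \<noteq> {}" using rp by (auto simp: I_def lessThan_empty_iff)
  have N_pos: "N > 0" using rp by (simp add: N_def)
  have \<Lambda>: "\<Lambda> > 0" unfolding \<Lambda>_def by (intro add_pos_nonneg) auto
  obtain J w w' where J: "finite J" "J \<subseteq> {0..1 + (4 * real r) * real m ^ 4}" "0 \<in> J" "1 \<in> J"
    and w: "\<And>x. x \<in> J \<Longrightarrow> w x \<ge> 0" and w': "\<And>x. x \<in> J \<Longrightarrow> w' x \<ge> 0"
    and w1: "(\<Sum>x\<in>J. w x) = 1" and w'1: "(\<Sum>x\<in>J. w' x) = 1"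
    and mom: "\<And>k. k \<le> m \<Longrightarrow> (\<Sum>x\<in>J. w x * x ^ k) = (\<Sum>x\<in>J. w' x * x ^ k)"
    and mean: "(\<Sum>x\<in>J. w' x * x) = 1" and light: "w' 1 \<ge> 2/5"
    and sparse: "(\<Sum>x\<in>J. w x * of_bool (x \<noteq> 0)) \<le> 1 / (1 + 4 * real r)"
    \<comment> \<open>With \<open>K = 4 * r\<close> a weight is nonzero with probability at most
      1/(1 + 4r). Times the at most \<open>r\<close> slots through a coordinate this is below 1/4,
      the base in \<open>privacy\<close>.\<close>
    by (rule moment_matching_weights[OF m, of "4 * real r"]) (use rp in \<open>simp; fail\<close>, blast)
  have J': "J \<subseteq> {0..\<Lambda>}" using J(2) by (simp add: \<Lambda>_def)
  let ?pt = "slot_point n p s"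
  have inj: "inj_on ?pt I" using inj_slot_point[OF s] .
  let ?X = "?pt ` I"
  have X: "?X \<subseteq> cube n" using slot_point_in_cube by auto
  define G where "G = (\<lambda>h i. h (?pt i)) ` (\<lambda>g. restrict g ?X) ` decision_lists n"
  have G_fin: "finite G" unfolding G_def by (intro finite_imageI[OF card_decision_list_patterns(1)[OF X]])
  have "card G \<le> fact n * 2 ^ n * 2 ^ (n + 1)"
    unfolding G_def
    using order.trans[OF card_image_le[OF card_decision_list_patterns(1)[OF X]] card_decision_list_patterns(2)[OF X]] .
  then have G_card: "real (card G) \<le> real (fact n * 2 ^ n * 2 ^ (n + 1))" by (simp only: of_nat_le_iff)
  obtain b where b: "iid_mean I J w' (\<lambda>lam.
      of_bool (\<exists>g\<in>G. real (card {i\<in>I. lam i = 1 \<and> b i \<noteq> g i}) < real (card I) / 20))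
    \<le> real (card G) * exp (- real (card I) / 20)"
    by (rule exists_hard_labels[OF finite_I J(1,4) w' w'1 light G_fin]; blast)
  define f where "f x = b (inv_into I ?pt x)" for x
  have f_pt: "f (?pt i) = b i" if "i \<in> I" for i using inv_into_f_f[OF inj that] by (simp add: f_def)
  let ?sim = "\<lambda>lam. rejection_mean I (tester_value ?pt f T) \<Lambda> lam (card I) q []"
  have range: "0 \<le> lam i \<and> lam i \<le> \<Lambda>" if "lam \<in> I \<rightarrow>\<^sub>E J" "i \<in> I" for lam i
    using PiE_mem[OF that] J' by auto
  let ?bad = "\<lambda>lam. \<exists>i\<in>I. \<not> private {j\<in>I. lam j \<noteq> 0} i"
  have yes: "iid_mean I J w ?sim \<ge> 2/3 - 1/100"
  proof -
    have "2/3 + (-1) * iid_mean I J w (\<lambda>lam. of_bool (?bad lam))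
        = iid_mean I J w (\<lambda>lam. 2/3 + (-1) * of_bool (?bad lam))"
      by (simp only: iid_mean_add iid_mean_cmult iid_mean_const[OF finite_I J(1) w1])
    also have "\<dots> \<le> iid_mean I J w ?sim"
    proof (intro iid_mean_mono w)
      fix lam assume lam: "lam \<in> I \<rightarrow>\<^sub>E J"
      have "0 \<le> ?sim lam"
        unfolding rejection_mean_eq_path_average[OF finite_I ne]
      proof (intro divide_nonneg_nonneg sum_nonneg)
        fix v assume "v \<in> {v. set v \<subseteq> I \<and> length v = card I}"
        then show "0 \<le> rejection_path (tester_value ?pt f T) \<Lambda> lam v q []"
          using rejection_path_bounds[of "tester_value ?pt f T" v lam \<Lambda> q "[]"] range[OF lam] \<Lambda>
          by (auto simp: tester_value_def pmf_le_1)
      qed auto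
      moreover have "2/3 \<le> ?sim lam" if "\<not> ?bad lam"
        by (rule rejection_mean_private_ge[OF ne _ \<Lambda>]; use range[OF lam] acc that in blast)
      ultimately show "2/3 + (-1) * of_bool (?bad lam) \<le> ?sim lam"
        by (cases "?bad lam") auto
    qed
    finally have A: "2/3 - iid_mean I J w (\<lambda>lam. of_bool (?bad lam)) \<le> iid_mean I J w ?sim" by simp
    have "iid_mean I J w (\<lambda>lam. of_bool (?bad lam)) \<le> real (card I) * (real r * (1 / (1 + 4 * real r))) ^ s"
      by (rule iid_mean_not_private_le[OF J(1) w w1 sparse])
    also have "\<dots> \<le> N * (1/4) ^ s"
      unfolding N using N_pos rp by (intro mult_left_mono power_mono) (auto simp: field_simps)
    also note privacy
    finally show ?thesis using A by simp
  qed
  let ?soft = "\<lambda>lam. \<exists>g\<in>G. real (card {i\<in>I. lam i = 1 \<and> b i \<noteq> g i}) < real (card I) / 20"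
  have no: "iid_mean I J w' ?sim \<le> 1/3 + 1/20 + 1/100 + 1/10"
  proof -
    \<comment> \<open>The last summand is Markov's inequality in pointwise form: it exceeds 1 when
      the total weight exceeds 10 N, and its mean is 1/10 because each weight has mean 1.\<close>
    have "iid_mean I J w' ?sim
        \<le> iid_mean I J w' (\<lambda>lam. (1/3 + 1/20) + (of_bool (?soft lam) + 1 / (10 * N) * (\<Sum>i\<in>I. lam i)))"
    proof (intro iid_mean_mono w')
      fix lam assume lam: "lam \<in> I \<rightarrow>\<^sub>E J"
      have S_nn: "sum lam I \<ge> 0" using range[OF lam] by (intro sum_nonneg) auto
      show "?sim lam \<le> (1/3 + 1/20) + (of_bool (?soft lam) + 1 / (10 * N) * (\<Sum>i\<in>I. lam i))"
      proof (cases "sum lam I \<le> 10 * N \<and> \<not> ?soft lam")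
        case True
        have "?sim lam \<le> 1/3 + 1/20"
        proof (rule rejection_mean_hard_le[OF ne _ \<Lambda>])
          fix g assume g: "g \<in> decision_lists n"
          have "(\<lambda>i. restrict g ?X (?pt i)) \<in> G"
            unfolding G_def using g by (intro image_eqI[where x = "restrict g ?X"] refl imageI)
          then have "real (card {i\<in>I. lam i = 1 \<and> b i \<noteq> restrict g ?X (?pt i)}) \<ge> real (card I) / 20"
            using True by (meson not_less)
          also have "{i\<in>I. lam i = 1 \<and> b i \<noteq> restrict g ?X (?pt i)} = {i\<in>I. lam i = 1 \<and> f (?pt i) \<noteq> g (?pt i)}"
            using f_pt by auto
          finally show "real (card I) / 20 \<le> real (card {i\<in>I. lam i = 1 \<and> f (?pt i) \<noteq> g (?pt i)})" .
        qed (use True q large N range[OF lam] rej in \<open>simp_all\<close>)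
        moreover have "1 / (10 * N) * sum lam I \<ge> 0" using S_nn N_pos by simp
        ultimately show ?thesis using True by simp
      next
        case False
        have "?sim lam \<le> 1"
        proof (cases "sum lam I > 0")
          case True
          then show ?thesis by (intro rejection_mean_le_one[OF ne _ \<Lambda>] range[OF lam])
        next
          case False
          then have S0: "sum lam I = 0" using S_nn by simp
          have "?sim lam = (1 - shortage 0 (card I) q) * accept_mean I (tester_value ?pt f T) lam 0 q [] + shortage 0 (card I) q"
            using rejection_mean_eq[OF finite_I ne, where lam = lam and \<Lambda> = \<Lambda> and R = "card I" and q = q and h = "[]"
              and \<tau> = "tester_value ?pt f T"] range[OF lam] \<Lambda> S0 by simp
          then show ?thesis by (cases "q = 0") (auto simp: shortage_zero tester_value_def pmf_le_1)
        qed
        moreover have "of_bool (?soft lam) + 1 / (10 * N) * sum lam I \<ge> 1"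
        proof (cases "?soft lam")
          case True
          have "1 / (10 * N) * sum lam I \<ge> 0" using S_nn N_pos by simp
          then show ?thesis using True by simp
        next
          case nsoft: False
          then have "sum lam I > 10 * N" using False by simp
          then have "1 / (10 * N) * sum lam I \<ge> 1" using N_pos by (simp add: field_simps)
          then show ?thesis using nsoft by simp
        qed
        ultimately show ?thesis by linarith
      qed
    qed
    also have "\<dots> = (1/3 + 1/20) + (iid_mean I J w' (\<lambda>lam. of_bool (?soft lam)) + 1 / (10 * N) * (\<Sum>i\<in>I. iid_mean I J w' (\<lambda>lam. lam i)))"
      by (simp only: iid_mean_add iid_mean_cmult iid_mean_sum iid_mean_const[OF finite_I J(1) w'1])
    also have "(\<Sum>i\<in>I. iid_mean I J w' (\<lambda>lam. lam i)) = N"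
      using iid_mean_coordinate[OF finite_I J(1) w'1, of _ "\<lambda>x. x"] mean N by simp
    also have "1 / (10 * N) * N = 1/10" using N_pos by simp
    also have "iid_mean I J w' (\<lambda>lam. of_bool (?soft lam)) \<le> 1/100"
    proof -
      note b
      also have "real (card G) * exp (- real (card I) / 20) \<le> real (fact n * 2 ^ n * 2 ^ (n + 1)) * exp (- N / 20)"
        unfolding N by (intro mult_right_mono G_card) auto
      also note labels
      finally show ?thesis .
    qed
    finally show ?thesis by simp
  qed
  have "iid_mean I J w ?sim \<le> iid_mean I J w' ?sim + 3 * real (card I) / 2 ^ Suc m"
    by (rule iid_mean_rejection_mean_close[OF finite_I ne J(1) J' \<Lambda> w w1 w' w'1 mom])
       (auto simp: tester_value_def pmf_le_1)
  then show False using yes no load unfolding N by linarith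
qed

end

section \<open>Choice of parameters\<close>

lemma parameters_eventually:
  "eventually (\<lambda>l::nat. 4 * real l ^ 3 * (real l + 4) ^ 2 \<le> 2 ^ l
     \<and> real l ^ 3 / (80 * (real l + 4)) \<ge> real l + 6
     \<and> 2 ^ l / (80000000 * real l ^ 5) \<ge> 5) at_top"
proof (intro eventually_conj)
  show "eventually (\<lambda>l::nat. 4 * real l ^ 3 * (real l + 4) ^ 2 \<le> 2 ^ l) at_top" by real_asymp
  show "eventually (\<lambda>l::nat. real l ^ 3 / (80 * (real l + 4)) \<ge> real l + 6) at_top" by real_asymp
  show "eventually (\<lambda>l::nat. 2 ^ l / (80000000 * real l ^ 5) \<ge> 5) at_top" by real_asymp
qed

text \<open>A tester for any class between the monotone conjunctions and the decision lists accepts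
  the former and rejects what is far from all of the latter. So a bound for this weaker notion
  covers every such class.\<close>

definition conjunction_dl_tester :: "nat \<Rightarrow> nat \<Rightarrow> sample_algorithm \<Rightarrow> bool" where
  "conjunction_dl_tester n q T \<longleftrightarrow>
     (\<forall>D f. set_pmf D \<subseteq> cube n \<longrightarrow>
        (f \<in> monotone_conjunctions n \<longrightarrow> pmf (run_on_samples q T D f) True \<ge> 2/3) \<and>
        (far_from (1/200) D (decision_lists n) f \<longrightarrow> pmf (run_on_samples q T D f) False \<ge> 2/3))"

lemma sample_lower_bound_eventually:
  "\<exists>c>0. \<exists>n\<^sub>0. \<forall>n\<ge>n\<^sub>0. \<forall>q T. conjunction_dl_tester n q T \<longrightarrow> real q \<ge> c * real n / ln (real n) ^ 5"
proof -
  \<comment> \<open>Here l is the integer part of log2 n. The first inequality yields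
    \<open>r * s \<le> p\<close> and \<open>N \<le> 4 ^ l / 50\<close>, the second lets N/20 exceed
    the logarithm of the number of decision lists, the third yields \<open>large\<close>.\<close>
  obtain l\<^sub>0 where l\<^sub>0: "\<And>l. l \<ge> l\<^sub>0 \<Longrightarrow> 4 * real l ^ 3 * (real l + 4) ^ 2 \<le> 2 ^ l
     \<and> real l ^ 3 / (80 * (real l + 4)) \<ge> real l + 6
     \<and> 2 ^ l / (80000000 * real l ^ 5) \<ge> 5"
    using parameters_eventually unfolding eventually_at_top_linorder by blast
  show ?thesis
  proof (intro exI[of _ "1 / 2560000000"] conjI exI[of _ "2 ^ (l\<^sub>0 + 1)"] allI impI)
    fix n q :: nat and T
    assume n: "n \<ge> 2 ^ (l\<^sub>0 + 1)"
      and T: "conjunction_dl_tester n q T"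
    have "n \<ge> 1" using n by (metis one_le_numeral one_le_power order.trans)
    then obtain l where l: "2 ^ l \<le> n" "n < 2 ^ (l + 1)"
      using ex_power_ivl1[of 2 n] by auto
    have "(2::nat) ^ (l\<^sub>0 + 1) < 2 ^ (l + 1)" using n l by linarith
    then have "l\<^sub>0 + 1 < l + 1" by (rule power_less_imp_less_exp[rotated]) simp
    then have "l \<ge> l\<^sub>0" "l \<ge> 1" by simp_all
    note e = l\<^sub>0[OF \<open>l \<ge> l\<^sub>0\<close>]
    \<comment> \<open>The union bound asks \<open>r\<close> to be at least 80 (l + 4) (l + 6), which
      \<open>l ^ 3\<close> eventually is. With these \<open>s\<close> and \<open>m\<close>,
      \<open>4 ^ s\<close> is 256 and \<open>2 ^ Suc m\<close> is 512 times \<open>4 ^ l\<close>, so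
      \<open>privacy\<close> and \<open>load\<close> follow from
      \<open>N \<le> 4 ^ l / 50\<close>.\<close>
    define s where "s = l + 4"
    define r where "r = l ^ 3"
    define p where "p = n div (2 * s)"
    define m where "m = 2 * l + 8"
    have ln: "real n \<ge> 2 ^ l" "real n \<le> 2 ^ (l + 1)"
      using l by (metis of_nat_le_iff of_nat_numeral of_nat_power less_imp_le)+
    have l1: "real l \<ge> 1" using \<open>l \<ge> 1\<close> by simp
    have s_pos: "real s > 0" by (simp add: s_def)
    have four_s: "4 * real s \<le> real n"
    proof -
      have "1 \<le> real s" by (simp add: s_def)
      from mult_left_mono[OF this, of "real s"] have "4 * real s \<le> 4 * (real s * real s)" by simp
      also have "\<dots> = 4 * 1 * (real l + 4) ^ 2" by (simp add: s_def power2_eq_square)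
      also have "\<dots> \<le> 4 * real l ^ 3 * (real l + 4) ^ 2"
        using l1 by (intro mult_right_mono mult_left_mono one_le_power) auto
      finally show ?thesis using e ln by linarith
    qed
    have n100: "real n \<ge> 100"
    proof -
      have "100 \<le> 4 * (1::real) * (1 + 4) ^ 2" by simp
      also have "\<dots> \<le> 4 * real l ^ 3 * (real l + 4) ^ 2"
        using l1 by (intro mult_mono power_mono one_le_power) auto
      finally show ?thesis using e ln by linarith
    qed
    have p_le: "real p \<le> real n" by (simp add: p_def)
    have p_ge: "real p \<ge> real n / (4 * real s)"
    proof -
      have "real n / (2 * real s) - 1 \<le> real p"
      proof -
        have "n < 2 * s + p * (2 * s)"
          unfolding p_def by (rule dividend_less_div_times) (simp add: s_def)
        then have "real n < real (2 * s + p * (2 * s))" by (simp only: of_nat_less_iff)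
        then have "real n \<le> (real p + 1) * (2 * real s)" by (simp add: distrib_right)
        then have "real n / (2 * real s) \<le> real p + 1" using s_pos by (subst pos_divide_le_eq) auto
        then show ?thesis by simp
      qed
      moreover have "real n / (4 * real s) \<ge> 1" using four_s s_pos by simp
      moreover have "real n / (2 * real s) = 2 * (real n / (4 * real s))" by simp
      ultimately show ?thesis by linarith
    qed
    have rs: "r * s \<le> p"
    proof -
      have "real (r * s) * (4 * real s) = 4 * real l ^ 3 * (real l + 4) ^ 2"
        by (simp add: r_def s_def power2_eq_square)
      also have "\<dots> \<le> real n" using e ln by linarith
      finally have "real (r * s) \<le> real n / (4 * real s)" using s_pos by (simp add: pos_le_divide_eq)
      then have "real (r * s) \<le> real p" using p_ge by linarith
      then show ?thesis by (simp only: of_nat_le_iff)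
    qed
    have ps: "2 * p * s \<le> n"
    proof -
      have "2 * p * s = n div (2 * s) * (2 * s)" by (simp add: p_def)
      also have "\<dots> \<le> n" by (rule div_times_less_eq_dividend)
      finally show ?thesis .
    qed
    interpret slots n p r s by standard (fact rs ps)+
    have N_le: "50 * real (r * p) \<le> 4 ^ l"
    proof -
      have "4 * real l ^ 3 * 5 ^ 2 \<le> 4 * real l ^ 3 * (real l + 4) ^ 2"
        using l1 by (intro mult_left_mono power_mono) auto
      then have "100 * real l ^ 3 \<le> 2 ^ l" using e by simp
      then have "100 * real l ^ 3 * real n \<le> 2 ^ l * 2 ^ (l + 1)" using ln by (intro mult_mono) auto
      moreover have "real (r * p) \<le> real l ^ 3 * real n"
        unfolding of_nat_mult r_def of_nat_power using p_le by (intro mult_left_mono) auto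
      moreover have "(2::real) ^ l * 2 ^ (l + 1) = 2 * 4 ^ l" by (simp flip: power_mult_distrib)
      ultimately show ?thesis by linarith
    qed
    then have N_frac: "real (r * p) / 4 ^ l \<le> 1/50" by (simp add: divide_le_eq)
    have N_ge: "real (r * p) \<ge> real l ^ 3 * (real n / (4 * (real l + 4)))"
      unfolding of_nat_mult r_def of_nat_power using p_ge by (intro mult_left_mono) (auto simp: s_def)
    define \<Lambda> where "\<Lambda> = 1 + 4 * real r * real m ^ 4"
    \<comment> \<open>As m is at most 10 l, \<Lambda> is at most 50000 l^7; as l + 4 is at most 5 l,
      N is at least l^2 n / 20. The constant is 20 * 80 * 50000.\<close>
    have bound: "real (r * p) / (80 * \<Lambda>) \<ge> real n / (80000000 * real l ^ 5)"
    proof -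
      have "real m ^ 4 \<le> (10 * real l) ^ 4" using l1 by (intro power_mono) (auto simp: m_def)
      then have "\<Lambda> \<le> 1 + 4 * real l ^ 3 * (10 * real l) ^ 4"
        unfolding \<Lambda>_def r_def of_nat_power by (intro add_left_mono mult_left_mono) auto
      also have "\<dots> = 1 + 40000 * real l ^ 7"
        by (simp add: power_mult_distrib)
      also have "\<dots> \<le> 50000 * real l ^ 7" using one_le_power[OF l1, of 7] by linarith
      finally have \<Lambda>_le: "\<Lambda> \<le> 50000 * real l ^ 7" .
      have \<Lambda>_pos: "\<Lambda> > 0" unfolding \<Lambda>_def by (intro add_pos_nonneg) auto
      have "real n / (80000000 * real l ^ 5) = real l ^ 3 * (real n / (20 * real l)) / (80 * (50000 * real l ^ 7))"
        using l1 by (simp add: field_simps eval_nat_numeral)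
      also have "\<dots> \<le> real l ^ 3 * (real n / (4 * (real l + 4))) / (80 * (50000 * real l ^ 7))"
        using l1 by (intro divide_right_mono mult_left_mono divide_left_mono) auto
      also have "\<dots> \<le> real (r * p) / (80 * (50000 * real l ^ 7))"
        using N_ge by (intro divide_right_mono) auto
      also have "\<dots> \<le> real (r * p) / (80 * \<Lambda>)"
        using \<Lambda>_le \<Lambda>_pos l1 by (intro divide_left_mono) auto
      finally show ?thesis .
    qed
    have "real q \<ge> real (r * p) / (80 * \<Lambda>)"
      unfolding \<Lambda>_def
    proof (rule sample_lower_bound)
      show "s \<ge> 2" "m \<ge> 1" by (simp_all add: s_def m_def)
      show "r \<ge> 1" using \<open>l \<ge> 1\<close> by (simp add: r_def)
      have "real p \<ge> 1" using p_ge four_s s_pos by (smt (verit) le_divide_eq_1_pos)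
      then show "p \<ge> 1" by simp
      show "real (r * p) * (1/4) ^ s \<le> 1/100"
      proof -
        have "real (r * p) * (1/4) ^ s = real (r * p) / 4 ^ l / 256"
          by (simp add: s_def power_add power_divide)
        also have "\<dots> \<le> 1/100" by (rule order.trans[OF divide_right_mono[OF N_frac]]) simp_all
        finally show ?thesis .
      qed
      show "3 * real (r * p) / 2 ^ Suc m \<le> 1/100"
      proof -
        have "3 * real (r * p) / 2 ^ Suc m = 3 * (real (r * p) / 4 ^ l) / 512"
          by (simp add: m_def power_add power_mult)
        also have "\<dots> \<le> 1/100"
          by (rule order.trans[OF divide_right_mono[OF mult_left_mono[OF N_frac]]]) simp_all
        finally show ?thesis .
      qed
      show "5 \<le> real (r * p) / (80 * (1 + 4 * real r * real m ^ 4))"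
      proof -
        have "2 ^ l / (80000000 * real l ^ 5) \<le> real n / (80000000 * real l ^ 5)"
          using ln by (intro divide_right_mono) auto
        then show ?thesis using e bound unfolding \<Lambda>_def by linarith
      qed
      show "real (fact n * 2 ^ n * 2 ^ (n + 1)) * exp (- real (r * p) / 20) \<le> 1/100"
      proof -
        have "(fact n :: nat) \<le> n ^ n" using fact_le_power[of n, where ?'a = nat] by simp
        also have "\<dots> \<le> (2 ^ (l + 1)) ^ n" using l by (intro power_mono) auto
        finally have "(fact n :: nat) * 2 ^ n * 2 ^ (n + 1) \<le> (2 ^ (l + 1)) ^ n * 2 ^ n * 2 ^ (n + 1)"
          by (intro mult_le_mono) auto
        also have "\<dots> = 2 ^ ((l + 1) * n + n + (n + 1))" by (simp only: power_add power_mult)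
        also have "\<dots> \<le> 2 ^ ((l + 4) * n)"
          using \<open>n \<ge> 1\<close> by (intro power_increasing) (auto simp: algebra_simps)
        finally have "real (fact n * 2 ^ n * 2 ^ (n + 1)) \<le> real (2 ^ ((l + 4) * n))"
          by (simp only: of_nat_le_iff)
        also have "\<dots> = 2 ^ ((l + 4) * n)" by simp
        also have "\<dots> \<le> exp 1 ^ ((l + 4) * n)"
          using exp_ge_add_one_self[of "1::real"] by (intro power_mono) auto
        also have "\<dots> = exp ((real l + 4) * real n)" by (simp flip: exp_of_nat_mult)
        finally have A: "real (fact n * 2 ^ n * 2 ^ (n + 1)) \<le> exp ((real l + 4) * real n)" .
        have "(real l + 6) * real n \<le> real l ^ 3 / (80 * (real l + 4)) * real n"
          using e by (intro mult_right_mono) auto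
        also have "\<dots> = real l ^ 3 * (real n / (4 * (real l + 4))) / 20" by simp
        also have "\<dots> \<le> real (r * p) / 20" using N_ge by (intro divide_right_mono) auto
        finally have B: "exp (- real (r * p) / 20) \<le> exp (- ((real l + 6) * real n))" by simp
        have "real (fact n * 2 ^ n * 2 ^ (n + 1)) * exp (- real (r * p) / 20)
            \<le> exp ((real l + 4) * real n) * exp (- ((real l + 6) * real n))"
          using A B by (intro mult_mono) auto
        also have "\<dots> = exp (- (2 * real n))" by (simp add: algebra_simps flip: exp_add)
        also have "\<dots> = 1 / exp (2 * real n)" by (simp add: exp_minus divide_inverse)
        also have "\<dots> \<le> 1/100"
        proof -
          have "100 \<le> exp (2 * real n)" using exp_ge_add_one_self[of "2 * real n"] n100 by linarith
          then show ?thesis by (intro divide_left_mono) auto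
        qed
        finally show ?thesis .
      qed
    qed (use T in \<open>auto simp: conjunction_dl_tester_def\<close>)
    also have "real (r * p) / (80 * \<Lambda>) \<ge> 1 / 2560000000 * real n / ln (real n) ^ 5"
    proof -
      \<comment> \<open>l is at most 2 ln n, so replacing l by the logarithm costs 2^5 = 32, and
        2560000000 is 32 times 80000000.\<close>
      have "ln (2 ^ l :: real) \<le> ln (real n)" using ln n100 by (subst ln_le_cancel_iff) auto
      then have "real l * ln 2 \<le> ln (real n)" by (simp add: ln_realpow)
      moreover have "real l * (1/2) \<le> real l * ln 2" using ln2_ge_two_thirds by (intro mult_left_mono) auto
      ultimately have "real l \<le> 2 * ln (real n)" by linarith
      then have "real l ^ 5 \<le> (2 * ln (real n)) ^ 5" by (intro power_mono) auto
      then have "real l ^ 5 \<le> 32 * ln (real n) ^ 5" by (simp add: power_mult_distrib)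
      then have "80000000 * real l ^ 5 \<le> 2560000000 * ln (real n) ^ 5" by simp
      then have "real n / (2560000000 * ln (real n) ^ 5) \<le> real n / (80000000 * real l ^ 5)"
        using l1 n100 by (intro divide_left_mono) auto
      then show ?thesis using bound by simp
    qed
    finally show "real q \<ge> 1 / 2560000000 * real n / ln (real n) ^ 5" .
  qed simp
qed

section \<open>The four classes\<close>

lemma permutes_onto_initial_segment:
  assumes "A \<subseteq> {1..n}"
  obtains \<pi> where "\<pi> permutes {1..n}" "\<pi> ` {1..card A} = A"
proof -
  have A: "finite A" "card A \<le> n"
    using assms finite_subset[OF assms] card_mono[OF _ assms] by auto
  obtain f where f: "bij_betw f {1..card A} A"
    using A(1) finite_same_card_bij[of "{1..card A}" A] by auto
  have "card ({1..n} - A) = n - card A" using assms A by (simp add: card_Diff_subset)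
  then obtain g where g: "bij_betw g {card A + 1..n} ({1..n} - A)"
    using finite_same_card_bij[of "{card A + 1..n}" "{1..n} - A"] by auto
  define \<pi> where "\<pi> j = (if j \<in> {1..card A} then f j else if j \<in> {card A + 1..n} then g j else j)" for j
  have "bij_betw \<pi> {1..card A} A" using f by (subst bij_betw_cong[of _ _ f]) (auto simp: \<pi>_def)
  moreover have "bij_betw \<pi> {card A + 1..n} ({1..n} - A)"
    using g by (subst bij_betw_cong[of _ _ g]) (auto simp: \<pi>_def)
  ultimately have "bij_betw \<pi> ({1..card A} \<union> {card A + 1..n}) (A \<union> ({1..n} - A))"
    by (intro bij_betw_combine) auto
  moreover have "{1..card A} \<union> {card A + 1..n} = {1..n}" using A(2) by auto
  moreover have "A \<union> ({1..n} - A) = {1..n}" using assms by auto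
  ultimately have "bij_betw \<pi> {1..n} {1..n}" by simp
  then have "\<pi> permutes {1..n}"
    using A(2) by (intro bij_imp_permutes) (auto simp: \<pi>_def)
  moreover have "\<pi> ` {1..card A} = A" using \<open>bij_betw \<pi> {1..card A} A\<close> by (simp add: bij_betw_def)
  ultimately show thesis by (rule that)
qed

text \<open>Query the variables of \<open>A\<close> first, answer false there and true afterwards:
  the value is false iff the first hit lies in \<open>A\<close>. As \<pi> and \<nu> are chosen
  before \<mu>, one list serves all sign patterns.\<close>

lemma eval_dl_avoid:
  assumes A: "A \<subseteq> {1..n}"
  obtains \<pi> \<nu> where "\<pi> permutes {1..n}" "\<nu> \<in> cube (n + 1)"
    "\<And>\<mu> x. eval_dl n \<pi> \<mu> \<nu> x \<longleftrightarrow> (\<forall>i\<in>A. x i \<noteq> \<mu> i)"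
proof -
  obtain \<pi> where \<pi>: "\<pi> permutes {1..n}" "\<pi> ` {1..card A} = A"
    by (rule permutes_onto_initial_segment[OF A])
  have cA: "card A \<le> n" using card_mono[OF _ A] by simp
  define \<nu> where "\<nu> = (\<lambda>j\<in>{1..n+1}. j > card A)"
  have "eval_dl n \<pi> \<mu> \<nu> x \<longleftrightarrow> (\<forall>i\<in>A. x i \<noteq> \<mu> i)" for \<mu> x
  proof (cases "\<exists>j\<in>{1..n}. x (\<pi> j) = \<mu> (\<pi> j)")
    case True
    let ?Q = "\<lambda>j. j \<in> {1..n} \<and> x (\<pi> j) = \<mu> (\<pi> j)"
    define k where "k = (LEAST j. ?Q j)"
    have ex: "\<exists>j. ?Q j" using True by blast
    have k: "?Q k" unfolding k_def by (rule LeastI_ex[OF ex])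
    have least: "k \<le> j" if "?Q j" for j unfolding k_def by (rule Least_le[of ?Q, OF that])
    have "eval_dl n \<pi> \<mu> \<nu> x = \<nu> k"
      unfolding eval_dl_def k_def by (rule if_P[OF True])
    also have "\<dots> \<longleftrightarrow> k > card A" using k by (simp add: \<nu>_def)
    also have "\<dots> \<longleftrightarrow> (\<forall>j\<in>{1..card A}. x (\<pi> j) \<noteq> \<mu> (\<pi> j))"
    proof
      assume "k > card A"
      then show "\<forall>j\<in>{1..card A}. x (\<pi> j) \<noteq> \<mu> (\<pi> j)" using least cA by fastforce
    next
      assume "\<forall>j\<in>{1..card A}. x (\<pi> j) \<noteq> \<mu> (\<pi> j)"
      then show "k > card A" using k by (meson atLeastAtMost_iff not_le)
    qed
    also have "\<dots> \<longleftrightarrow> (\<forall>i\<in>\<pi> ` {1..card A}. x i \<noteq> \<mu> i)" by blast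
    finally show ?thesis unfolding \<pi>(2) .
  next
    case False
    then have "\<forall>i\<in>\<pi> ` {1..card A}. x i \<noteq> \<mu> i" using cA by auto
    moreover have "eval_dl n \<pi> \<mu> \<nu> x" using False cA by (auto simp: eval_dl_def \<nu>_def)
    ultimately show ?thesis unfolding \<pi>(2) by blast
  qed
  moreover have "\<nu> \<in> cube (n + 1)" by (simp add: \<nu>_def cube_def)
  ultimately show thesis using that \<pi>(1) by blast
qed

lemma avoid_in_decision_lists:
  assumes "A \<subseteq> {1..n}" "\<And>x. x \<in> cube n \<Longrightarrow> f x \<longleftrightarrow> (\<forall>i\<in>A. x i \<noteq> \<mu> i)"
  shows "f \<in> decision_lists n"
proof -
  obtain \<pi> \<nu> where d: "\<pi> permutes {1..n}" "\<nu> \<in> cube (n + 1)"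
    "\<And>\<mu> x. eval_dl n \<pi> \<mu> \<nu> x \<longleftrightarrow> (\<forall>i\<in>A. x i \<noteq> \<mu> i)"
    by (rule eval_dl_avoid[OF assms(1)]; blast)
  have "\<forall>x\<in>cube n. f x = eval_dl n \<pi> (restrict \<mu> {1..n}) \<nu> x"
    using assms d(3) by (auto simp: subset_iff)
  moreover have "restrict \<mu> {1..n} \<in> cube n" by (simp add: cube_def)
  ultimately show ?thesis using d(1,2) unfolding decision_lists_def by blast
qed

lemma monotone_conjunctions_subset_conjunctions: "monotone_conjunctions n \<subseteq> conjunctions n"
proof
  fix f assume "f \<in> monotone_conjunctions n"
  then obtain E where "E \<subseteq> {1..n}" "\<forall>x\<in>cube n. f x \<longleftrightarrow> (\<forall>i\<in>E. x i)"
    unfolding monotone_conjunctions_def by blast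
  then show "f \<in> conjunctions n"
    unfolding conjunctions_def mem_Collect_eq by (intro exI[of _ E] exI[of _ "{}"]) simp
qed

lemma eval_dl_in_image: "eval_dl n \<pi> \<mu> \<nu> x \<in> \<nu> ` {1..n + 1}"
proof (cases "\<exists>j\<in>{1..n}. x (\<pi> j) = \<mu> (\<pi> j)")
  case True
  then have ex: "\<exists>j. j \<in> {1..n} \<and> x (\<pi> j) = \<mu> (\<pi> j)" by blast
  show ?thesis
    unfolding eval_dl_def if_P[OF True] using LeastI_ex[OF ex] by (intro imageI) simp
qed (simp add: eval_dl_def)

lemma conjunctions_subset_decision_lists: "conjunctions n \<subseteq> decision_lists n"
proof
  fix f assume "f \<in> conjunctions n"
  from this[unfolded conjunctions_def mem_Collect_eq] obtain P N where PN: "P \<subseteq> {1..n}" "N \<subseteq> {1..n}"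
    and f': "\<forall>x\<in>cube n. f x \<longleftrightarrow> (\<forall>i\<in>P. x i) \<and> (\<forall>i\<in>N. \<not> x i)"
    by (elim exE conjE)
  note f = bspec[OF f']
  show "f \<in> decision_lists n"
  proof (cases "P \<inter> N = {}")
    case True
    show ?thesis
    proof (rule avoid_in_decision_lists[of "P \<union> N" _ _ "\<lambda>i. i \<in> N"])
      show "P \<union> N \<subseteq> {1..n}" using PN by simp
      show "f x \<longleftrightarrow> (\<forall>i\<in>P \<union> N. x i \<noteq> (i \<in> N))" if "x \<in> cube n" for x
        using f[OF that] True by blast
    qed
  next
    \<comment> \<open>A contradictory conjunction is constant 0 on the cube, hence given by any list
      that only answers false.\<close>
    case False
    then have "\<not> f x" if "x \<in> cube n" for x using f[OF that] by blast
    then have "\<forall>x\<in>cube n. f x = eval_dl n id (\<lambda>i\<in>{1..n}. True) (\<lambda>j\<in>{1..n+1}. False) x"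
      using eval_dl_in_image[of n id "\<lambda>i\<in>{1..n}. True" "\<lambda>j\<in>{1..n+1}. False"] by auto
    then show ?thesis unfolding decision_lists_def mem_Collect_eq
      by (intro exI[of _ id] exI[of _ "\<lambda>i\<in>{1..n}. True"] exI[of _ "\<lambda>j\<in>{1..n+1}. False"])
         (auto simp: cube_def permutes_id)
  qed
qed

section \<open>Negating all coordinates\<close>

definition flip :: "nat \<Rightarrow> (nat \<Rightarrow> bool) \<Rightarrow> nat \<Rightarrow> bool" where
  "flip n x = (\<lambda>i\<in>{1..n}. \<not> x i)"

lemma flip_in_cube: "flip n x \<in> cube n"
  by (simp add: flip_def cube_def)

lemma flip_flip: "x \<in> cube n \<Longrightarrow> flip n (flip n x) = x"
  by (rule ext) (simp add: flip_def cube_def PiE_iff extensional_def restrict_def)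

text \<open>A conjunction looks for a 0 in \<open>E\<close>, while the rules of a monotone list test
  for 1; negation turns one into the other.\<close>

lemma monotone_conjunction_flip:
  assumes "f \<in> monotone_conjunctions n"
  shows "f \<circ> flip n \<in> monotone_decision_lists n"
proof -
  obtain E where E: "E \<subseteq> {1..n}" "\<forall>x\<in>cube n. f x \<longleftrightarrow> (\<forall>i\<in>E. x i)"
    using assms[unfolded monotone_conjunctions_def mem_Collect_eq] by (elim exE conjE)
  obtain \<pi> \<nu> where d: "\<pi> permutes {1..n}" "\<nu> \<in> cube (n + 1)"
    "\<And>\<mu> x. eval_dl n \<pi> \<mu> \<nu> x \<longleftrightarrow> (\<forall>i\<in>E. x i \<noteq> \<mu> i)"
    by (rule eval_dl_avoid[OF E(1)]; blast)
  have "(f \<circ> flip n) x = eval_dl n \<pi> (\<lambda>i\<in>{1..n}. True) \<nu> x" for x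
    using bspec[OF E(2) flip_in_cube] E(1) d(3) by (auto simp: flip_def subset_iff)
  then show ?thesis using d(1,2) unfolding monotone_decision_lists_def by blast
qed

text \<open>Negation turns tests for 1 into tests for 0, so the composition is given by the same
  rules with \<mu> constantly 0. Distance from all decision lists therefore carries over to distance
  from monotone ones.\<close>

lemma monotone_decision_list_flip:
  assumes "g \<in> monotone_decision_lists n"
  shows "g \<circ> flip n \<in> decision_lists n"
proof -
  obtain \<pi> \<nu> where d: "\<pi> permutes {1..n}" "\<nu> \<in> cube (n + 1)"
    and g: "\<forall>x\<in>cube n. g x = eval_dl n \<pi> (\<lambda>i\<in>{1..n}. True) \<nu> x"
    using assms[unfolded monotone_decision_lists_def mem_Collect_eq] by (elim exE conjE)
  have "(j \<in> {1..n} \<and> flip n x (\<pi> j) = (\<lambda>i\<in>{1..n}. True) (\<pi> j)) = (j \<in> {1..n} \<and> x (\<pi> j) = (\<lambda>i\<in>{1..n}. False) (\<pi> j))"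
    for x j
    using permutes_in_image[OF d(1), of j] by (auto simp: flip_def)
  then have "eval_dl n \<pi> (\<lambda>i\<in>{1..n}. True) \<nu> (flip n x) = eval_dl n \<pi> (\<lambda>i\<in>{1..n}. False) \<nu> x" for x
    unfolding eval_dl_def Bex_def by (simp only:)
  then have "\<forall>x\<in>cube n. (g \<circ> flip n) x = eval_dl n \<pi> (\<lambda>i\<in>{1..n}. False) \<nu> x"
    using bspec[OF g flip_in_cube] by simp
  moreover have "(\<lambda>i\<in>{1..n}. False) \<in> cube n" by (simp add: cube_def)
  ultimately show ?thesis using d unfolding decision_lists_def by blast
qed

text \<open>Negates the points but keeps the labels: a tester for monotone decision lists becomes
  one for \<open>conjunction_dl_tester\<close>, at the same number of samples.\<close>

definition flip_tester :: "nat \<Rightarrow> sample_algorithm \<Rightarrow> sample_algorithm" where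
  "flip_tester n T zs = T (map (\<lambda>(z, y). (flip n z, y)) zs)"

lemma run_flip_tester:
  assumes "set_pmf D \<subseteq> cube n"
  shows "run_on_samples q (flip_tester n T) D f = run_on_samples q T (map_pmf (flip n) D) (f \<circ> flip n)"
  unfolding run_on_samples_map
  unfolding run_on_samples_def flip_tester_def map_map
proof (intro bind_pmf_cong refl arg_cong[where f = T] map_cong)
  fix zs z assume "zs \<in> set_pmf (replicate_pmf q D)" "z \<in> set zs"
  then have "z \<in> cube n" using assms by (auto simp: set_replicate_pmf)
  then show "((\<lambda>(z, y). (flip n z, y)) \<circ> (\<lambda>z. (z, f z))) z = (flip n z, (f \<circ> flip n) (flip n z))"
    by (simp add: flip_flip)
qed

lemma far_from_flip:
  assumes D: "set_pmf D \<subseteq> cube n" and far: "far_from \<epsilon> D (decision_lists n) f"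
  shows "far_from \<epsilon> (map_pmf (flip n) D) (monotone_decision_lists n) (f \<circ> flip n)"
  unfolding far_from_def
proof
  fix g assume "g \<in> monotone_decision_lists n"
  then have "\<epsilon> \<le> measure_pmf.prob D {x. f x \<noteq> (g \<circ> flip n) x}"
    using far monotone_decision_list_flip unfolding far_from_def by blast
  also have "\<dots> = measure_pmf.prob D {x. (f \<circ> flip n) (flip n x) \<noteq> g (flip n x)}"
    using D by (intro measure_pmf.finite_measure_eq_AE) (auto simp: AE_measure_pmf_iff flip_flip subset_iff)
  also have "\<dots> = measure_pmf.prob (map_pmf (flip n) D) {x. (f \<circ> flip n) x \<noteq> g x}"
    by (simp add: vimage_def)
  finally show "\<epsilon> \<le> measure_pmf.prob (map_pmf (flip n) D) {x. (f \<circ> flip n) x \<noteq> g x}" .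
qed

lemma far_from_mono:
  assumes "far_from \<delta> D C f" "\<epsilon> \<le> \<delta>" "C' \<subseteq> C"
  shows "far_from \<epsilon> D C' f"
  using assms unfolding far_from_def by (meson order.trans subsetD)

theorem theorem1p3:
  "\<exists>\<epsilon>\<^sub>0 > (0::real). \<forall>\<epsilon>. 0 < \<epsilon> \<and> \<epsilon> \<le> \<epsilon>\<^sub>0 \<longrightarrow>
     (\<forall>C \<in> {decision_lists, monotone_conjunctions, conjunctions, monotone_decision_lists}.
        \<exists>c > (0::real). \<exists>(k::nat) (n\<^sub>0::nat). \<forall>n \<ge> n\<^sub>0. \<forall>(q::nat) T.
          sample_based_df_tester n (C n) \<epsilon> q T \<longrightarrow>
          real q \<ge> c * real n / ln (real n) ^ k)"
proof (rule exI[of _ "1/200"], intro conjI allI impI ballI)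
  fix \<epsilon> :: real and C :: "nat \<Rightarrow> ((nat \<Rightarrow> bool) \<Rightarrow> bool) set"
  assume "0 < \<epsilon> \<and> \<epsilon> \<le> 1/200"
    and C: "C \<in> {decision_lists, monotone_conjunctions, conjunctions, monotone_decision_lists}"
  then have \<epsilon>: "\<epsilon> \<le> 1/200" by simp
  obtain c :: real and n\<^sub>0 :: nat where c: "c > 0"
    and bound: "\<And>n q T. n \<ge> n\<^sub>0 \<Longrightarrow> conjunction_dl_tester n q T \<Longrightarrow> real q \<ge> c * real n / ln (real n) ^ 5"
    using sample_lower_bound_eventually by blast
  have "real q \<ge> c * real n / ln (real n) ^ 5"
    if n: "n \<ge> n\<^sub>0" and T: "sample_based_df_tester n (C n) \<epsilon> q T" for n q T
  proof (cases "C = monotone_decision_lists")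
    case False
    then have sub: "monotone_conjunctions n \<subseteq> C n" "C n \<subseteq> decision_lists n"
      using C monotone_conjunctions_subset_conjunctions[of n] conjunctions_subset_decision_lists[of n] by auto
    have "conjunction_dl_tester n q T"
      unfolding conjunction_dl_tester_def
    proof (intro allI impI conjI)
      fix D f assume D: "set_pmf D \<subseteq> cube n"
      show "pmf (run_on_samples q T D f) True \<ge> 2/3" if "f \<in> monotone_conjunctions n"
        using T D that sub(1) unfolding sample_based_df_tester_def by blast
      show "pmf (run_on_samples q T D f) False \<ge> 2/3" if "far_from (1/200) D (decision_lists n) f"
        using T D far_from_mono[OF that \<epsilon> sub(2)] unfolding sample_based_df_tester_def by blast
    qed
    then show ?thesis by (rule bound[OF n])
  next
    case True
    have "conjunction_dl_tester n q (flip_tester n T)"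
      unfolding conjunction_dl_tester_def
    proof (intro allI impI conjI)
      fix D f assume D: "set_pmf D \<subseteq> cube n"
      have D': "set_pmf (map_pmf (flip n) D) \<subseteq> cube n" using flip_in_cube by auto
      note T' = T[unfolded sample_based_df_tester_def True, rule_format, OF D', of "f \<circ> flip n"]
      show "pmf (run_on_samples q (flip_tester n T) D f) True \<ge> 2/3" if "f \<in> monotone_conjunctions n"
        unfolding run_flip_tester[OF D] using T' monotone_conjunction_flip[OF that] by blast
      show "pmf (run_on_samples q (flip_tester n T) D f) False \<ge> 2/3" if "far_from (1/200) D (decision_lists n) f"
        unfolding run_flip_tester[OF D]
        using T' far_from_mono[OF far_from_flip[OF D that] \<epsilon> order.refl] by blast
    qed
    then show ?thesis by (rule bound[OF n])
  qed
  then show "\<exists>c>0. \<exists>k n\<^sub>0. \<forall>n\<ge>n\<^sub>0. \<forall>q T. sample_based_df_tester n (C n) \<epsilon> q T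
      \<longrightarrow> c * real n / ln (real n) ^ k \<le> real q"
    using c by blast
qed simp

end
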